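(* Let $N\ge1$. For every $M\in\mathcal{M}(\Omega_W)$, the $(2N+1)\times(2N+1)$ coefficient matrix $A(M)$ of the EQMOM-derived moment system has $2N+1$ distinct real eigenvalues. That is, the EQMOM-derived moment system $\partial_tM+A(M)\partial_xM=\nu S(M)$ is strictly hyperbolic.
   Context: Notation. $\Delta_j(u,\vartheta)$ denotes the $j$th moment $\int_{\mathbb R}\xi^j\frac{1}{\sqrt{2\pi\vartheta}}e^{-(\xi-u)^2/(2\vartheta)}d\xi$ of the Gaussian with mean $u$ and variance $\vartheta>0$; it is a polynomial in $u$ and $\vartheta$. EQMOM with $N$ nodes. For $W=(w_1,u_1,\dots,w_N,u_N,\sigma^2)^T\in\mathbb{R}^{2N+1}$ let $\mathcal{M}(W)=(M_0,\dots,M_{2N})^T$ with $M_j=\sum_{i=1}^N w_i\Delta_j(u_i,\sigma^2)$. The domain is $\Omega_W=\Omega_W^{open}\cup\Omega_W^{eq}$, where $\Omega_W^{open}=\{W: w_i>0,\ \sigma^2>0,\ u_i\ne u_j\ \forall i\ne j\}$ and $\Omega_W^{eq}=\{W: w_i>0,\ \sigma^2>0,\ u_1=\dots=u_N\}$. Coefficient matrix. $A(M)$ is the $(2N+1)\times(2N+1)$ matrix whose entries in position $(k,k+1)$ equal $1$ for $1\le k\le 2N$, whose last row is $(a_0,\dots,a_{2N})$, and whose other entries are zero. For $M\in\mathcal{M}(\Omega_W^{open})$, $M$ determines $W\in\Omega_W^{open}$ up to relabeling the pairs $(w_i,u_i)$, so $\bar M_{2N+1}=\sum_{i=1}^Nw_i\Delta_{2N+1}(u_i,\sigma^2)$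 is a (smooth) function of $M$, and $a_j=\partial\bar M_{2N+1}/\partial M_j$. For $M=\mathcal{M}(W)$ with $W\in\Omega_W^{eq}$ and $u_1=\dots=u_N=U$, the $a_j$ are defined (by continuous extension) through $$u^{2N+1}-a_{2N}u^{2N}-\dots-a_1u-a_0=\sum_{k\ge0}\frac{1}{k!}\Big(-\frac{\sigma^2}{2}\Big)^k\frac{d^{2k}}{du^{2k}}(u-U)^{2N+1}.$$ The source term $\nu S(M)$ plays no role in this statement. *)

theory Defs
  imports "HOL-Probability.Probability" "Jordan_Normal_Form.Char_Poly"
begin

(* HOL-Analysis also provides a type "vec" and infix "$"; both refer to
   Jordan_Normal_Form.Matrix here. *)
hide_type (open) Finite_Cartesian_Product.vec
hide_const (open) Finite_Cartesian_Product.vec Finite_Cartesian_Product.vec_nth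
no_notation Finite_Cartesian_Product.vec_nth (infixl \<open>$\<close> 90)

(* normal_density takes the standard deviation, theta is the variance. *)
definition gauss_moment :: "nat \<Rightarrow> real \<Rightarrow> real \<Rightarrow> real" where
  "gauss_moment j u \<theta> = (LINT \<xi>|lborel. \<xi> ^ j * normal_density u (sqrt \<theta>) \<xi>)"

(* W = (w_1, u_1, ..., w_N, u_N, sigma^2) is a vector of dimension 2 N + 1; both
   vector entries and nodes are indexed from 0. *)
definition weight :: "real vec \<Rightarrow> nat \<Rightarrow> real" where
  "weight W i = W $ (2 * i)"

definition node :: "real vec \<Rightarrow> nat \<Rightarrow> real" where
  "node W i = W $ (2 * i + 1)"

definition sigma2 :: "nat \<Rightarrow> real vec \<Rightarrow> real" where
  "sigma2 N W = W $ (2 * N)"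

definition moment :: "nat \<Rightarrow> real vec \<Rightarrow> nat \<Rightarrow> real" where
  "moment N W j = (\<Sum>i<N. weight W i * gauss_moment j (node W i) (sigma2 N W))"

definition moment_map :: "nat \<Rightarrow> real vec \<Rightarrow> real vec" where
  "moment_map N W = Matrix.vec (2 * N + 1) (moment N W)"

definition Omega_open :: "nat \<Rightarrow> real vec set" where
  "Omega_open N = {W \<in> carrier_vec (2 * N + 1).
     (\<forall>i<N. weight W i > 0) \<and> sigma2 N W > 0 \<and>
     (\<forall>i<N. \<forall>j<N. i \<noteq> j \<longrightarrow> node W i \<noteq> node W j)}"

definition Omega_eq :: "nat \<Rightarrow> real vec set" where
  "Omega_eq N = {W \<in> carrier_vec (2 * N + 1).
     (\<forall>i<N. weight W i > 0) \<and> sigma2 N W > 0 \<and>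
     (\<forall>i<N. \<forall>j<N. node W i = node W j)}"

definition Omega_W :: "nat \<Rightarrow> real vec set" where
  "Omega_W N = Omega_open N \<union> Omega_eq N"

(* The closure: the moment of order 2 N + 1 as a function of M = (M_0, ..., M_{2N}).
   The preimage W is unique up to relabelling, which does not affect the value. *)
definition Mbar :: "nat \<Rightarrow> real vec \<Rightarrow> real" where
  "Mbar N M =
     moment N (SOME W. W \<in> Omega_open N \<and> moment_map N W = M) (2 * N + 1)"

definition partial_deriv :: "(real vec \<Rightarrow> real) \<Rightarrow> nat \<Rightarrow> real vec \<Rightarrow> real" where
  "partial_deriv f j M = deriv (\<lambda>t. f (M + t \<cdot>\<^sub>v unit_vec (dim_vec M) j)) 0"

(* The sum over all k of (1/k!) (-sigma^2/2)^k (d/du)^(2k) (u - U)^(2N+1);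
   the terms with k > N are derivatives of order > 2 N + 1, hence zero. *)
definition eq_poly :: "nat \<Rightarrow> real \<Rightarrow> real \<Rightarrow> real poly" where
  "eq_poly N U s2 =
     (\<Sum>k\<le>N. Polynomial.smult (1 / fact k * (- s2 / 2) ^ k) ((pderiv ^^ (2 * k)) ([:- U, 1:] ^ (2 * N + 1))))"

(* In the second case the monic polynomial u^(2N+1) - a_{2N} u^(2N) - ... - a_0 is
   eq_poly, and the choice of W only concerns the weights: U and sigma^2 are determined
   by M. For N = 1 both cases apply to every M, and they give the same coefficients;
   for N > 1 they exclude each other. *)
definition closure_coeff :: "nat \<Rightarrow> real vec \<Rightarrow> nat \<Rightarrow> real" where
  "closure_coeff N M j =
     (if M \<in> moment_map N ` Omega_open N then partial_deriv (Mbar N) j M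
      else let W = (SOME W. W \<in> Omega_eq N \<and> moment_map N W = M)
           in - Polynomial.coeff (eq_poly N (node W 0) (sigma2 N W)) j)"

definition coeff_matrix :: "nat \<Rightarrow> real vec \<Rightarrow> real mat" where
  "coeff_matrix N M = Matrix.mat (2 * N + 1) (2 * N + 1)
     (\<lambda>(i, j). if i = 2 * N then closure_coeff N M j else if j = i + 1 then 1 else 0)"

(* Strict hyperbolicity on D of the n-dimensional system with coefficient matrix A
   (the source term does not enter). *)
definition strictly_hyperbolic :: "nat \<Rightarrow> real vec set \<Rightarrow> (real vec \<Rightarrow> real mat) \<Rightarrow> bool" where
  "strictly_hyperbolic n D A \<longleftrightarrow>
     (\<forall>M\<in>D. A M \<in> carrier_mat n n \<and> card {x :: real. eigenvalue (A M) x} = n)"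

end

theory Submission
  imports Defs
begin

text \<open>
  Averaging a polynomial against a Gaussian of mean $u$ and variance $t$ means to apply
  $e^{(t/2)D^2}$, the heat flow for time $t$, and to evaluate at $u$. The moment functional of a state is
  therefore the sum over the atoms $w_i \delta_{u_i}$ composed with the heat flow for time $\sigma^2$.

  Let $c(x) = x^{2N+1} - \sum_j a_j x^j$ be the characteristic polynomial of the coefficient matrix, and
  let $q$ be $c$ after the heat flow for time $\sigma^2$. The $a_j$ are the derivatives of the next
  moment exactly if the moment functional, evaluated at the fixed polynomial $c$, is stationary
  under all changes of the state. Changing a weight gives $q(u_i) = 0$, changing a node gives
  $q'(u_i) = 0$, changing the variance gives $\sum_i w_i q''(u_i) = 0$. Hence
  $q = (x - \alpha) \prod_i (x - u_i)^2$, where $\alpha$ is a weighted mean of the nodes. For states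
  whose nodes all equal $U$ the coefficients are given by $q = (x - U)^{2N+1}$. In both cases $q$ has only real
  roots, and $c$ is $q$ moved by the backward heat flow for the time $\sigma^2 > 0$. This flow separates
  real roots (\<open>heat_backward_distinct_real_roots\<close>): inserting a factor $x - r$ into the
  initial polynomial replaces the evolved polynomial $f$ by $(x - r) f - \sigma^2 f'$, which changes
  sign between consecutive roots of $f$. So $c$ has $2N+1$ distinct real roots, and these
  are the eigenvalues (\<open>eigenvalue_coeff_matrix_iff\<close>).

  Two points need more work. The closure must be well defined: \<open>mixture_determined\<close> shows that
  the moments up to order $2N$ determine the next one, by testing two functionals against the square
  of a node polynomial. And the closure must be differentiable with the derivatives found above. As the number
  of moments is arbitrary, the perturbed states are constructed directly. A state of variance $t$ with given
  moments exists if the functional, after the flow for time $t$ is undone, is positive definite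
  on degree less than $N$ and has a null vector of degree $N$ with real simple roots; its nodes
  are these roots, by Gauss quadrature. If one moment changes by $e$, the variance for which a null
  vector exists is found by the intermediate value theorem for the determinant of a Gram matrix
  (\<open>eventually_null_vector\<close>), and it moves by $O(e)$, as does the null vector
  (\<open>null_vector_bound\<close>). By stationarity the error of the linear approximation is then
  $o(e)$ (\<open>next_moment_tendsto\<close>), without any differentiability of the state itself.
\<close>

section \<open>The heat flow on polynomials and Gaussian averages\<close>

text \<open>
  The operator $e^{(t/2)D^2}$, that is the heat flow run for time $t$. It is allowed to run backwards:
  on polynomials the exponential series is finite, so negative $t$ is as good as positive $t$.
\<close>

definition heat :: "real \<Rightarrow> real poly \<Rightarrow> real poly" where
  "heat t P = (\<Sum>k\<le>Polynomial.degree P.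
     Polynomial.smult ((t / 2) ^ k / fact k) ((pderiv ^^ (2 * k)) P))"

lemma higher_pderiv_eq_0:
  fixes P :: "real poly"
  assumes "Polynomial.degree P < n"
  shows "(pderiv ^^ n) P = 0"
  using assms by (intro poly_eqI) (simp add: coeff_higher_pderiv coeff_eq_0)

lemma heat_eq_sum:
  assumes "Polynomial.degree P \<le> 2 * n + 1"
  shows "heat t P = (\<Sum>k\<le>n. Polynomial.smult ((t / 2) ^ k / fact k) ((pderiv ^^ (2 * k)) P))"
proof -
  define f where "f k = Polynomial.smult ((t / 2) ^ k / fact k) ((pderiv ^^ (2 * k)) P)" for k
  have f0: "f k = 0" if "2 * k > Polynomial.degree P" for k
    using that by (simp add: f_def higher_pderiv_eq_0)
  have "sum f {..Polynomial.degree P} = sum f {..Polynomial.degree P + n}"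
    by (rule sum.mono_neutral_left) (auto intro!: f0)
  also have "\<dots> = sum f {..n}"
    using assms by (intro sum.mono_neutral_right) (auto intro!: f0)
  finally show ?thesis by (simp add: heat_def f_def)
qed

lemma heat_0 [simp]: "heat t 0 = 0"
  by (simp add: heat_def)

lemma heat_zero_time [simp]: "heat 0 P = P"
proof -
  have "heat 0 P = (\<Sum>k\<le>Polynomial.degree P. if k = 0 then P else 0)"
    unfolding heat_def by (intro sum.cong) auto
  thus ?thesis by simp
qed

lemma heat_const [simp]: "heat t [:c:] = [:c:]"
  by (simp add: heat_def)

lemma pCons_0_sum: "(\<Sum>k\<in>A. pCons 0 (f k)) = pCons 0 (\<Sum>k\<in>A. f k)"
  by (induction A rule: infinite_finite_induct) simp_all

lemma heat_add: "heat t (P + Q) = heat t P + heat t Q"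
proof -
  define n where "n = max (Polynomial.degree P) (Polynomial.degree Q)"
  have "Polynomial.degree (P + Q) \<le> n" unfolding n_def by (rule degree_add_le_max)
  thus ?thesis
    by (subst (1 2 3) heat_eq_sum[where n = n])
       (auto simp: n_def higher_pderiv_add smult_add_right sum.distrib)
qed

lemma heat_smult: "heat t (Polynomial.smult c P) = Polynomial.smult c (heat t P)"
  using degree_smult_le[of c P]
  by (subst (1 2) heat_eq_sum[where n = "Polynomial.degree P"])
     (auto simp: higher_pderiv_smult smult_sum2 mult.commute)

lemma heat_sum: "heat t (sum f A) = (\<Sum>x\<in>A. heat t (f x))"
  by (induction A rule: infinite_finite_induct) (simp_all add: heat_add)

lemma higher_pderiv_pCons_0:
  fixes P :: "real poly"
  shows "(pderiv ^^ n) (pCons 0 P) = pCons 0 ((pderiv ^^ n) P) + of_nat n * (pderiv ^^ (n - 1)) P"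
proof (induction n)
  case (Suc n)
  have "(pderiv ^^ Suc n) (pCons 0 P) =
      pderiv (pCons 0 ((pderiv ^^ n) P) + of_nat n * (pderiv ^^ (n - 1)) P)"
    by (simp only: funpow.simps o_apply Suc)
  also have "\<dots> = pCons 0 ((pderiv ^^ Suc n) P) + (pderiv ^^ n) P
      + of_nat n * pderiv ((pderiv ^^ (n - 1)) P)"
    by (simp add: pderiv_add pderiv_mult pderiv_pCons)
  also have "of_nat n * pderiv ((pderiv ^^ (n - 1)) P) = of_nat n * (pderiv ^^ n) P"
    by (cases n) simp_all
  finally show ?case
    by (simp add: algebra_simps)
qed simp

lemma heat_pderiv: "heat t (pderiv P) = pderiv (heat t P)"
  by (subst (1 2) heat_eq_sum[where n = "Polynomial.degree P"])
     (auto simp: degree_pderiv pderiv_smult pderiv_sum higher_pderiv_sum simp flip: funpow_swap1)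

text \<open>
  The commutator of the flow with multiplication by the variable is $t D$, since
  $D^{2k}(xP) = x D^{2k}P + 2k D^{2k-1}P$. Together with linearity this recursion determines the
  flow, and the later facts about it are proved by induction along it.
\<close>

lemma heat_pCons: "heat t (pCons a P) = pCons a (heat t P) + Polynomial.smult t (pderiv (heat t P))"
proof -
  define n where "n = Polynomial.degree P"
  define c where "c k = (t / 2) ^ k / fact k" for k
  have X: "heat t (pCons 0 P) = pCons 0 (heat t P) + Polynomial.smult t (pderiv (heat t P))"
  proof -
    have "heat t (pCons 0 P) = (\<Sum>k\<le>Suc n. Polynomial.smult (c k) ((pderiv ^^ (2 * k)) (pCons 0 P)))"
      unfolding c_def by (rule heat_eq_sum) (simp add: n_def)
    also have "\<dots> = (\<Sum>k\<le>Suc n. pCons 0 (Polynomial.smult (c k) ((pderiv ^^ (2 * k)) P)))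
        + (\<Sum>k\<le>Suc n. Polynomial.smult (c k * of_nat (2 * k)) ((pderiv ^^ (2 * k - 1)) P))"
      unfolding higher_pderiv_pCons_0
      by (simp add: smult_add_right sum.distrib of_nat_poly del: sum.atMost_Suc)
    also have "(\<Sum>k\<le>Suc n. pCons 0 (Polynomial.smult (c k) ((pderiv ^^ (2 * k)) P))) =
        pCons 0 (\<Sum>k\<le>Suc n. Polynomial.smult (c k) ((pderiv ^^ (2 * k)) P))"
      by (rule pCons_0_sum)
    also have "(\<Sum>k\<le>Suc n. Polynomial.smult (c k) ((pderiv ^^ (2 * k)) P)) = heat t P"
      unfolding c_def by (rule heat_eq_sum [symmetric]) (simp add: n_def)
    also have "(\<Sum>k\<le>Suc n. Polynomial.smult (c k * of_nat (2 * k)) ((pderiv ^^ (2 * k - 1)) P)) =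
        (\<Sum>k\<le>n. Polynomial.smult (c (Suc k) * of_nat (2 * Suc k)) ((pderiv ^^ (2 * Suc k - 1)) P))"
      by (subst sum.atMost_Suc_shift) simp
    also have "\<dots> = (\<Sum>k\<le>n. Polynomial.smult (t * c k) (pderiv ((pderiv ^^ (2 * k)) P)))"
    proof (rule sum.cong)
      fix k
      have "c (Suc k) = t / 2 * c k / real (Suc k)" by (simp add: c_def)
      hence "c (Suc k) * real (2 * Suc k) = t * c k" by (simp add: field_simps)
      thus "Polynomial.smult (c (Suc k) * of_nat (2 * Suc k)) ((pderiv ^^ (2 * Suc k - 1)) P) =
          Polynomial.smult (t * c k) (pderiv ((pderiv ^^ (2 * k)) P))"
        by simp
    qed simp
    also have "\<dots> = Polynomial.smult t (pderiv (\<Sum>k\<le>n. Polynomial.smult (c k) ((pderiv ^^ (2 * k)) P)))"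
      by (simp add: higher_pderiv_sum[of 1, simplified] pderiv_smult smult_sum2)
    also have "(\<Sum>k\<le>n. Polynomial.smult (c k) ((pderiv ^^ (2 * k)) P)) = heat t P"
      unfolding c_def by (rule heat_eq_sum [symmetric]) (simp add: n_def)
    finally show ?thesis .
  qed
  have "pCons a P = [:a:] + pCons 0 P" by simp
  hence "heat t (pCons a P) = [:a:] + heat t (pCons 0 P)" by (metis heat_add heat_const)
  thus ?thesis by (simp add: X)
qed

lemma heat_mult_linear:
  "heat t ([:- r, 1:] * P) = [:- r, 1:] * heat t P + Polynomial.smult t (pderiv (heat t P))"
proof -
  have "[:- r, 1:] * Q = pCons 0 Q + Polynomial.smult (- r) Q" for Q
    by (simp add: mult_pCons_left)
  thus ?thesis by (simp only: heat_add heat_smult heat_pCons)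
qed

lemma heat_heat: "heat s (heat t P) = heat (s + t) P"
proof (induction P)
  case (pCons a P)
  have "pCons a (heat t P) = [:a:] + pCons 0 (heat t P)" by simp
  show ?case
    by (simp add: heat_pCons heat_add heat_smult heat_pderiv pCons.IH smult_add_left)
qed simp

lemma heat_degree_coeff:
  "Polynomial.degree (heat t P) \<le> Polynomial.degree P \<and>
   Polynomial.coeff (heat t P) (Polynomial.degree P) = lead_coeff P"
proof (induction P)
  case (pCons a P)
  show ?case
  proof (cases "P = 0")
    case False
    let ?H = "heat t P"
    have "Polynomial.degree (pderiv ?H) \<le> Polynomial.degree P"
      using pCons.IH by (auto simp: degree_pderiv)
    moreover have "Polynomial.coeff (pderiv ?H) (Suc (Polynomial.degree P)) = 0"
      using pCons.IH by (simp add: coeff_pderiv coeff_eq_0)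
    moreover have "Polynomial.degree (pCons a ?H) \<le> Suc (Polynomial.degree P)"
      using pCons.IH by (meson degree_pCons_le le_trans Suc_le_mono)
    ultimately show ?thesis using False pCons.IH
      by (auto simp: heat_pCons intro!: degree_add_le)
  qed (simp)
qed simp

lemma degree_heat [simp]: "Polynomial.degree (heat t P) = Polynomial.degree P"
  using heat_degree_coeff[of t P] heat_degree_coeff[of "-t" "heat t P"]
  by (simp add: heat_heat)

lemma lead_coeff_heat: "lead_coeff (heat t P) = lead_coeff P"
  using heat_degree_coeff[of t P] by simp

text \<open>
  Both values come from the recursion $m_{k+2} = t (k+1) m_k$, which the central Gaussian moments
  obey as well.
\<close>

lemma heat_translated_power_even:
  "poly (heat t ([:- u, 1:] ^ (2 * k))) u = fact (2 * k) / (2 ^ k * fact k) * t ^ k"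
and heat_translated_power_odd:
  "poly (heat t ([:- u, 1:] ^ (2 * k + 1))) u = 0"
proof -
  have step: "poly (heat t ([:- u, 1:] ^ Suc (Suc n))) u =
      t * real (Suc n) * poly (heat t ([:- u, 1:] ^ n)) u" for n
  proof -
    have "heat t ([:- u, 1:] ^ Suc (Suc n)) = [:- u, 1:] * heat t ([:- u, 1:] ^ Suc n) +
        Polynomial.smult t (heat t (pderiv ([:- u, 1:] ^ Suc n)))"
      by (subst power_Suc) (simp only: heat_mult_linear heat_pderiv)
    also have "pderiv ([:- u, 1:] ^ Suc n) = Polynomial.smult (real (Suc n)) ([:- u, 1:] ^ n)"
      by (subst pderiv_power_Suc) (simp add: pderiv_pCons)
    finally show ?thesis by (simp add: heat_smult)
  qed
  have one: "heat t 1 = 1" using heat_const[of t 1] by (simp add: one_pCons)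
  show "poly (heat t ([:- u, 1:] ^ (2 * k))) u = fact (2 * k) / (2 ^ k * fact k) * t ^ k"
  proof (induction k)
    case (Suc k)
    have "poly (heat t ([:- u, 1:] ^ (2 * Suc k))) u = 
      t * real (Suc (2 * k)) * poly (heat t ([:- u, 1:] ^ (2 * k))) u"
      using step[of "2 * k"] by (simp only: mult_Suc_right add_2_eq_Suc)
    also have "\<dots> = fact (2 * Suc k) / (2 ^ Suc k * fact (Suc k)) * t ^ Suc k"
      unfolding Suc by (simp add: divide_simps)
    finally show ?case .
  qed (simp add: one)
  show "poly (heat t ([:- u, 1:] ^ (2 * k + 1))) u = 0"
  proof (induction k)
    case 0
    show ?case using heat_mult_linear[of t u 1] by (simp add: one)
  next
    case (Suc k)
    have "poly (heat t ([:- u, 1:] ^ (2 * Suc k + 1))) u = 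
      t * real (Suc (2 * k + 1)) * poly (heat t ([:- u, 1:] ^ (2 * k + 1))) u"
      using step[of "2 * k + 1"] by simp
    thus ?case by (subst (asm) Suc) simp
  qed
qed

text \<open>
  Averaging a polynomial against the Gaussian of mean $u$ and variance $t$ is the same as running the
  heat flow for time $t$ and evaluating at $u$. Expanding in powers of $x - u$ reduces
  this to the central moments.
\<close>

lemma has_bochner_integral_poly_normal_density:
  assumes "t > 0"
  shows "has_bochner_integral lborel (\<lambda>x. poly P x * normal_density u (sqrt t) x) (poly (heat t P) u)"
proof -
  define B where "B k = [:- u, 1:] ^ k" for k
  have base: "has_bochner_integral lborel (\<lambda>x. poly (B k) x * normal_density u (sqrt t) x)
      (poly (heat t (B k)) u)" for k
  proof -
    have s: "sqrt t > 0" using assms by simp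
    show ?thesis
    proof (cases "even k")
      case True
      then obtain m where m: "k = 2 * m" by (elim evenE)
      have "fact (2 * m) / ((2 / (sqrt t)\<^sup>2) ^ m * fact m) = fact (2 * m) / (2 ^ m * fact m) * t ^ m"
        using assms by (simp add: power_divide field_simps)
      thus ?thesis using normal_moment_even[OF s, of u m] heat_translated_power_even[of t u m]
        unfolding m B_def by (simp add: mult.commute)
    next
      case False
      then obtain m where m: "k = 2 * m + 1" by (elim oddE)
      show ?thesis
        using normal_moment_odd[OF s, of u m] heat_translated_power_odd[of t u m]
        unfolding m B_def by (simp only: poly_power poly_pCons mult.commute) (simp add: mult.commute)
    qed
  qed
  define Q where "Q = pcompose P [:u, 1:]"
  have "P = pcompose Q [:- u, 1:]"
    by (simp add: Q_def pcompose_pCons flip: pcompose_assoc)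
  also have "\<dots> = (\<Sum>k\<le>Polynomial.degree Q. Polynomial.smult (Polynomial.coeff Q k) (B k))"
    
  proof (rule poly_eq_poly_eq_iff [THEN iffD1, OF ext])
    fix x
    have "poly (pcompose Q [:- u, 1:]) x = poly Q (x - u)" by (simp add: poly_pcompose)
    also have "\<dots> = (\<Sum>k\<le>Polynomial.degree Q. Polynomial.coeff Q k * (x - u) ^ k)"
      by (rule poly_altdef)
    finally show "poly (pcompose Q [:- u, 1:]) x =
        poly (\<Sum>k\<le>Polynomial.degree Q. Polynomial.smult (Polynomial.coeff Q k) (B k)) x"
      by (simp add: poly_sum B_def)
  qed
  finally have P: "P = (\<Sum>k\<le>Polynomial.degree Q. Polynomial.smult (Polynomial.coeff Q k) (B k))" .
  have "has_bochner_integral lborel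
      (\<lambda>x. \<Sum>k\<le>Polynomial.degree Q. Polynomial.coeff Q k * (poly (B k) x * normal_density u (sqrt t) x))
      (\<Sum>k\<le>Polynomial.degree Q. Polynomial.coeff Q k * poly (heat t (B k)) u)"
    by (intro has_bochner_integral_sum has_bochner_integral_mult_right base)
  thus ?thesis
    by (subst (1 2) P) (simp add: poly_sum heat_sum heat_smult sum_distrib_right mult.assoc)
qed

lemma gauss_moment_eq_heat:
  assumes "t > 0"
  shows "gauss_moment j u t = poly (heat t (Polynomial.monom 1 j)) u"
  using has_bochner_integral_poly_normal_density[OF assms, of "Polynomial.monom 1 j" u]
  by (simp add: gauss_moment_def poly_monom has_bochner_integral_integral_eq)

text \<open>
  A nonnegative polynomial that is not zero vanishes only on a null set, so its Gaussian average is
  strictly positive.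
\<close>

lemma poly_heat_pos:
  assumes "t > 0" "P \<noteq> 0" and nonneg: "\<And>x. poly P x \<ge> 0"
  shows "poly (heat t P) u > 0"
proof -
  define f where "f x = poly P x * normal_density u (sqrt t) x" for x
  have s: "sqrt t > 0" using assms by simp
  have f: "has_bochner_integral lborel f (poly (heat t P) u)"
    unfolding f_def by (rule has_bochner_integral_poly_normal_density) fact
  have f_nonneg: "f x \<ge> 0" for x by (simp add: f_def nonneg)
  have "integral\<^sup>L lborel f \<noteq> 0"
  proof
    assume "integral\<^sup>L lborel f = 0"
    moreover have "integrable lborel f" using f by (rule integrable.intros)
    ultimately have "AE x in lborel. f x = 0"
      using f_nonneg by (subst (asm) integral_nonneg_eq_0_iff_AE) auto
    hence "AE x in lborel. x \<in> {x. poly P x = 0}"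
      by eventually_elim (use normal_density_pos[OF s] in \<open>auto simp: f_def less_le\<close>)
    moreover have "finite {x. poly P x = 0}" by (rule poly_roots_finite) fact
    hence "AE x in lborel. x \<notin> {x. poly P x = 0}"
      by (rule AE_not_in[OF finite_imp_null_set_lborel])
    ultimately have "AE x in (lborel :: real measure). False" by eventually_elim auto
    thus False by (simp add: eventually_False ae_filter_eq_bot_iff)
  qed
  moreover have "integral\<^sup>L lborel f \<ge> 0" using f_nonneg by simp
  ultimately show ?thesis using has_bochner_integral_integral_eq[OF f] by simp
qed

section \<open>Real roots under the backward heat flow\<close>

abbreviation monic_with_roots :: "nat \<Rightarrow> (nat \<Rightarrow> real) \<Rightarrow> real poly" where
  "monic_with_roots n r \<equiv> (\<Prod>i<n. [:- r i, 1:])"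

lemma monic_with_roots_degree [simp]: "Polynomial.degree (monic_with_roots n r) = n"
  by (subst degree_prod_eq_sum_degree) auto

lemma monic_with_roots_coeff [simp]: "Polynomial.coeff (monic_with_roots n r) n = 1"
proof -
  have "lead_coeff (monic_with_roots n r) = 1" by (subst lead_coeff_prod) simp
  thus ?thesis by (simp only: monic_with_roots_degree)
qed

lemma poly_monic_with_roots: "poly (monic_with_roots n r) x = (\<Prod>i<n. x - r i)"
  by (simp add: poly_prod)

lemma poly_monic_with_roots_eq_0 [simp]: "i < n \<Longrightarrow> poly (monic_with_roots n r) (r i) = 0"
  by (auto simp: poly_prod)

lemma poly_pderiv_monic_with_roots:
  assumes "k < n"
  shows "poly (pderiv (monic_with_roots n r)) (r k) = (\<Prod>j\<in>{..<n} - {k}. r k - r j)"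
proof -
  have "poly (pderiv (monic_with_roots n r)) (r k) =
      (\<Sum>a<n. \<Prod>j\<in>{..<n} - {a}. r k - r j)"
    by (simp add: pderiv_prod poly_sum poly_prod pderiv_pCons)
  also have "\<dots> = (\<Sum>a<n. if a = k then \<Prod>j\<in>{..<n} - {k}. r k - r j else 0)"
    using assms by (intro sum.cong) (auto intro!: bexI[of _ k])
  also have "\<dots> = (\<Prod>j\<in>{..<n} - {k}. r k - r j)" using assms by simp
  finally show ?thesis .
qed

text \<open>
  At the $k$-th of $n$ increasing roots, exactly the $n-1-k$ factors that belong to larger roots are
  negative.
\<close>

lemma pderiv_sign_at_root:
  fixes x :: "nat \<Rightarrow> real"
  assumes "\<And>k l. k < l \<Longrightarrow> l < n \<Longrightarrow> x k < x l" and "k < n"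
  shows "(- 1) ^ (n - 1 - k) * (\<Prod>j\<in>{..<n} - {k}. x k - x j) > 0"
proof -
  have split: "{..<n} - {k} = {..<k} \<union> {k<..<n}" using assms(2) by auto
  have "(\<Prod>j\<in>{..<n} - {k}. x k - x j) = (\<Prod>j<k. x k - x j) * (\<Prod>j\<in>{k<..<n}. (-1) * (x j - x k))"
    unfolding split by (subst prod.union_disjoint) auto
  also have "(\<Prod>j\<in>{k<..<n}. (-1) * (x j - x k)) =
      (-1) ^ (n - 1 - k) * (\<Prod>j\<in>{k<..<n}. x j - x k)"
    unfolding prod.distrib by simp
  finally have "(- 1) ^ (n - 1 - k) * (\<Prod>j\<in>{..<n} - {k}. x k - x j) =
      ((- 1) ^ (n - 1 - k) * (- 1) ^ (n - 1 - k)) *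
      ((\<Prod>j<k. x k - x j) * (\<Prod>j\<in>{k<..<n}. x j - x k))" by (simp only: mult_ac)
  also have "(- 1) ^ (n - 1 - k) * (- 1) ^ (n - 1 - k) = (1::real)"
    by (simp flip: power_mult_distrib)
  finally show ?thesis
    using assms by (auto intro!: mult_pos_pos prod_pos)
qed

lemma monic_poly_sign_at_infinity:
  fixes d :: "real poly"
  assumes "lead_coeff d = 1"
  obtains R where "\<And>x. x \<ge> R \<Longrightarrow> poly d x > 0"
    and "\<And>x. x \<le> - R \<Longrightarrow> (- 1) ^ Polynomial.degree d * poly d x > 0"
proof -
  define e where "e = Polynomial.smult ((- 1) ^ Polynomial.degree d) (pcompose d [:0, - 1:])"
  have "lead_coeff (pcompose d [:0, - 1:]) = (- 1) ^ Polynomial.degree d"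
    using assms by (subst lead_coeff_comp) auto
  hence "lead_coeff e = 1"
    by (simp only: e_def lead_coeff_smult) (simp flip: power_mult_distrib)
  then obtain R1 where R1: "\<And>x. x \<ge> R1 \<Longrightarrow> poly e x \<ge> 1"
    using poly_pinfty_gt_lc[of e] by auto
  obtain R2 where R2: "\<And>x. x \<ge> R2 \<Longrightarrow> poly d x \<ge> 1"
    using poly_pinfty_gt_lc[of d] assms by auto
  show ?thesis
  proof (rule that)
    fix x assume "x \<ge> max R1 R2"
    thus "poly d x > 0" using R2[of x] by auto
  next
    fix x assume "x \<le> - max R1 R2"
    hence "poly e (- x) \<ge> 1" by (intro R1) auto
    thus "(- 1) ^ Polynomial.degree d * poly d x > 0" by (simp add: e_def poly_pcompose)
  qed
qed

text \<open>
  At a root of \<open>c\<close> the polynomial \<open>d\<close> equals $-t c'$, and $c'$ alternates in sign along the simple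
  roots of \<open>c\<close>. Since \<open>d\<close> is monic of one degree more, the signs continue to alternate at both
  infinities, which makes $n+1$ sign changes in total.
\<close>

lemma heat_backward_step:
  fixes x :: "nat \<Rightarrow> real"
  assumes t: "t > 0"
    and x: "\<And>k l. k < l \<Longrightarrow> l < n \<Longrightarrow> x k < x l"
    and c: "c = monic_with_roots n x"
    and d: "d = [:- r, 1:] * c - Polynomial.smult t (pderiv c)"
  obtains y where "\<And>k l. k < l \<Longrightarrow> l < Suc n \<Longrightarrow> y k < y l" "d = monic_with_roots (Suc n) y"
proof -
  have c_deg: "Polynomial.degree c = n" "Polynomial.coeff c n = 1" by (simp_all add: c)
  have "Polynomial.degree ([:- r, 1:] * c) \<le> Suc n"
    using degree_mult_le[of "[:- r, 1:]" c] c_deg by simp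
  moreover have "Polynomial.degree (Polynomial.smult t (pderiv c)) \<le> Suc n"
    using c_deg t by (simp add: degree_pderiv)
  ultimately have d_deg_le: "Polynomial.degree d \<le> Suc n"
    unfolding d by (rule degree_diff_le)
  have d_coeff: "Polynomial.coeff d (Suc n) = 1"
    using c_deg by (simp add: d coeff_pderiv coeff_eq_0)
  with d_deg_le have d_deg: "Polynomial.degree d = Suc n"
    by (intro antisym le_degree) auto
  have "lead_coeff d = 1" using d_deg d_coeff by simp
  then obtain R where R1: "\<And>x. x \<ge> R \<Longrightarrow> poly d x > 0"
    and R2: "\<And>x. x \<le> - R \<Longrightarrow> (- 1) ^ Polynomial.degree d * poly d x > 0"
    by (rule monic_poly_sign_at_infinity) auto
  define A where "A = - (\<bar>R\<bar> + \<bar>x 0\<bar> + 1)"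
  define B where "B = \<bar>R\<bar> + \<bar>x (n - 1)\<bar> + 1"
  \<comment> \<open>The points at which the sign of \<open>d\<close> is known: the roots of \<open>c\<close>, with one point far out on either side.\<close>
  define z where "z k = (if k = 0 then A else if k \<le> n then x (k - 1) else B)" for k
  have z_less: "z k < z (Suc k)" if "k < Suc n" for k
    using that x[of "k - 1" k] by (auto simp: z_def A_def B_def not_le less_Suc_eq)
  have z_sign: "(- 1) ^ (Suc n - k) * poly d (z k) > 0" if k: "k \<le> Suc n" for k
  proof -
    consider "k = 0" | "k = Suc n" | l where "k = Suc l" "l < n"
      using k by (cases k) force+
    thus ?thesis
    proof cases
      case 1
      thus ?thesis using R2[of A] d_deg by (simp add: z_def A_def)
    next
      case 2
      thus ?thesis using R1[of B] by (simp add: z_def B_def)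
    next
      case 3
      have "poly d (x l) = - t * (\<Prod>j\<in>{..<n} - {l}. x l - x j)"
        using 3 by (simp add: d c poly_pderiv_monic_with_roots)
      moreover have "Suc n - k = Suc (n - 1 - l)" using 3 by simp
      ultimately have "(- 1) ^ (Suc n - k) * poly d (z k) =
          t * ((- 1) ^ (n - 1 - l) * (\<Prod>j\<in>{..<n} - {l}. x l - x j))"
        using 3 by (simp add: z_def)
      moreover have "\<dots> > 0"
        using pderiv_sign_at_root[OF x \<open>l < n\<close>] t by (rule mult_pos_pos[rotated])
      ultimately show ?thesis by simp
    qed
  qed
  have z_change: "poly d (z k) * poly d (z (Suc k)) < 0" if k: "k < Suc n" for k
  proof -
    have "Suc n - k = Suc (Suc n - Suc k)" using k by simp
    hence "(- 1) ^ (Suc n - k) * poly d (z k) = - ((- 1) ^ (Suc n - Suc k) * poly d (z k))"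
      by simp
    hence "(- 1) ^ (Suc n - Suc k) * poly d (z k) < 0" using z_sign[of k] k by linarith
    moreover have "(- 1) ^ (Suc n - Suc k) * poly d (z (Suc k)) > 0" using z_sign[of "Suc k"] k by simp
    ultimately have "((- 1) ^ (Suc n - Suc k) * poly d (z k)) *
        ((- 1) ^ (Suc n - Suc k) * poly d (z (Suc k))) < 0" by (rule mult_neg_pos)
    also have "((- 1) ^ (Suc n - Suc k) * poly d (z k)) *
        ((- 1) ^ (Suc n - Suc k) * poly d (z (Suc k))) =
        ((- 1) ^ (Suc n - Suc k) * (- 1) ^ (Suc n - Suc k)) * (poly d (z k) * poly d (z (Suc k)))"
      by (simp only: mult_ac)
    also have "(- 1) ^ (Suc n - Suc k) * (- 1) ^ (Suc n - Suc k) = (1 :: real)"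
      by (simp flip: power_mult_distrib)
    finally show ?thesis by simp
  qed
  have "\<exists>y. z k < y \<and> y < z (Suc k) \<and> poly d y = 0" if "k < Suc n" for k
    using poly_IVT[OF z_less[OF that] z_change[OF that]] by blast
  then obtain y where y: "\<And>k. k < Suc n \<Longrightarrow> z k < y k \<and> y k < z (Suc k) \<and> poly d (y k) = 0"
    by metis
  have y_less: "y k < y l" if "k < l" "l < Suc n" for k l
    using that
  proof (induction l)
    case (Suc l)
    have "y l < y (Suc l)" using y[of l] y[of "Suc l"] Suc.prems by force
    thus ?case using Suc by (cases "k = l") auto
  qed simp
  have "inj_on y {..<Suc n}"
    by (rule inj_onI) (metis y_less lessThan_iff less_irrefl linorder_neqE_nat)
  hence card: "card (y ` {..<Suc n}) = Suc n" by (simp add: card_image)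
  have "d = monic_with_roots (Suc n) y"
  proof (rule poly_eqI_degree_lead_coeff[where n = "Suc n" and A = "y ` {..<Suc n}"])
    show "poly d w = poly (monic_with_roots (Suc n) y) w" if "w \<in> y ` {..<Suc n}" for w
      using that y by (auto simp del: prod.lessThan_Suc)
  qed (use card d_coeff d_deg monic_with_roots_coeff[of y "Suc n"]
       in \<open>simp_all del: prod.lessThan_Suc add: monic_with_roots_degree\<close>)
  with y_less that show ?thesis by blast
qed

text \<open>
  The factors are put in one at a time: by the commutator identity, multiplying by $x - r$ before
  the backward flow has the effect of the previous lemma after it. Roots of the given polynomial may
  coincide; the flow separates them.
\<close>

lemma heat_backward_distinct_real_roots:
  assumes t: "t > 0"
  shows "\<exists>x. (\<forall>k l. k < l \<longrightarrow> l < n \<longrightarrow> x k < x l) \<and>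
    heat (- t) (monic_with_roots n r) = monic_with_roots n x"
proof (induction n)
  case 0
  show ?case using heat_const[of "-t" 1] by (simp add: one_pCons)
next
  case (Suc n)
  then obtain x where x: "\<And>k l. k < l \<Longrightarrow> l < n \<Longrightarrow> x k < x l"
    and c: "heat (- t) (monic_with_roots n r) = monic_with_roots n x" by blast
  have "monic_with_roots (Suc n) r = [:- r n, 1:] * monic_with_roots n r"
    by (simp add: mult.commute)
  hence "heat (- t) (monic_with_roots (Suc n) r) =
      [:- r n, 1:] * monic_with_roots n x - Polynomial.smult t (pderiv (monic_with_roots n x))"
    using c by (simp only: heat_mult_linear) simp
  from heat_backward_step[OF t x refl this] obtain y
    where "\<And>k l. k < l \<Longrightarrow> l < Suc n \<Longrightarrow> y k < y l"
      and "heat (- t) (monic_with_roots (Suc n) r) = monic_with_roots (Suc n) y" by blast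
  thus ?case by blast
qed

lemma card_roots_heat_backward:
  assumes "t > 0"
  shows "card {x. poly (heat (- t) (monic_with_roots n r)) x = 0} = n"
proof -
  obtain x where x: "\<And>k l. k < l \<Longrightarrow> l < n \<Longrightarrow> x k < x l"
    and eq: "heat (- t) (monic_with_roots n r) = monic_with_roots n x"
    using heat_backward_distinct_real_roots[OF assms, of n r] by blast
  have "{y. poly (heat (- t) (monic_with_roots n r)) y = 0} = x ` {..<n}"
    unfolding eq by (auto simp: poly_prod)
  moreover have "inj_on x {..<n}"
    by (rule inj_onI) (metis x lessThan_iff less_irrefl linorder_neqE_nat)
  ultimately show ?thesis by (simp add: card_image)
qed

section \<open>Eigenvalues of the coefficient matrix\<close>

text \<open>
  The first $2N$ rows force an eigenvector for $x$ to be a multiple of $(1, x, \dots, x^{2N})$, and the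
  last row then says that $x$ is a root of \<open>c\<close>.
\<close>

lemma eigenvalue_coeff_matrix_iff:
  assumes deg: "Polynomial.degree c = 2 * N + 1" and monic: "lead_coeff c = 1"
    and coeffs: "\<And>j. j \<le> 2 * N \<Longrightarrow> closure_coeff N M j = - Polynomial.coeff c j"
  shows "eigenvalue (coeff_matrix N M) x \<longleftrightarrow> poly c x = 0"
proof -
  let ?n = "2 * N + 1"
  let ?A = "coeff_matrix N M"
  have A: "?A \<in> carrier_mat ?n ?n" by (simp add: coeff_matrix_def)
  have upper: "(?A *\<^sub>v v) $ i = v $ Suc i" if "v \<in> carrier_vec ?n" "i < 2 * N" for v i
  proof -
    have "(?A *\<^sub>v v) $ i = (\<Sum>j = 0..<?n. (if j = i + 1 then 1 else 0) * v $ j)"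
      using that by (auto simp: coeff_matrix_def scalar_prod_def intro!: sum.cong)
    also have "\<dots> = (\<Sum>j = 0..<?n. if j = i + 1 then v $ j else 0)"
      by (intro sum.cong) auto
    also have "\<dots> = v $ Suc i" using that by (subst sum.delta) auto
    finally show ?thesis .
  qed
  have last: "(?A *\<^sub>v v) $ (2 * N) = (\<Sum>j<?n. - Polynomial.coeff c j * v $ j)"
    if "v \<in> carrier_vec ?n" for v
    using that coeffs
    by (auto simp: coeff_matrix_def scalar_prod_def atLeast0LessThan intro!: sum.cong)
  have pc: "poly c x = x ^ ?n + (\<Sum>j<?n. Polynomial.coeff c j * x ^ j)"
    using deg monic by (simp add: poly_altdef lessThan_Suc_atMost[symmetric])
  show ?thesis
  proof
    assume "eigenvalue ?A x"
    then obtain v where v: "v \<in> carrier_vec ?n" "v \<noteq> 0\<^sub>v ?n" and ev: "?A *\<^sub>v v = x \<cdot>\<^sub>v v"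
      using A by (auto simp: eigenvalue_def eigenvector_def)
    have pow: "v $ i = x ^ i * v $ 0" if "i < ?n" for i
      using that
    proof (induction i)
      case (Suc i)
      have "v $ Suc i = x * v $ i" using upper[OF v(1), of i] Suc.prems v(1) by (simp add: ev)
      thus ?case using Suc by simp
    qed simp
    have "v $ 0 \<noteq> 0"
    proof
      assume "v $ 0 = 0"
      have "v $ i = 0" if "i < ?n" for i
        unfolding pow[OF that] \<open>v $ 0 = 0\<close> by simp
      hence "v = 0\<^sub>v ?n" using v(1) by (intro eq_vecI) auto
      thus False using v(2) by simp
    qed
    have "x * v $ (2 * N) = (\<Sum>j<?n. - Polynomial.coeff c j * v $ j)"
      using last[OF v(1)] v(1) by (simp add: ev)
    also have "\<dots> = (\<Sum>j<?n. - (Polynomial.coeff c j * x ^ j * v $ 0))"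
    proof (intro sum.cong refl)
      fix j assume "j \<in> {..<?n}"
      thus "- Polynomial.coeff c j * v $ j = - (Polynomial.coeff c j * x ^ j * v $ 0)"
        by (subst pow) auto
    qed
    also have "x * v $ (2 * N) = x ^ ?n * v $ 0" using pow[of "2 * N"] by simp
    finally have "poly c x * v $ 0 = 0"
      unfolding pc by (simp add: distrib_right sum_distrib_right sum_negf del: sum.lessThan_Suc)
    thus "poly c x = 0" using \<open>v $ 0 \<noteq> 0\<close> by simp
  next
    assume root: "poly c x = 0"
    define v where "v = Matrix.vec ?n (\<lambda>i. x ^ i)"
    have v: "v \<in> carrier_vec ?n" by (simp add: v_def)
    have "v $ 0 \<noteq> 0" by (simp add: v_def)
    hence "v \<noteq> 0\<^sub>v ?n" by auto
    moreover have "?A *\<^sub>v v = x \<cdot>\<^sub>v v"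
    proof (rule eq_vecI)
      fix i assume "i < dim_vec (x \<cdot>\<^sub>v v)"
      hence i: "i < ?n" using v by simp
      show "(?A *\<^sub>v v) $ i = (x \<cdot>\<^sub>v v) $ i"
      proof (cases "i = 2 * N")
        case True
        have "(?A *\<^sub>v v) $ i = - (\<Sum>j<?n. Polynomial.coeff c j * x ^ j)"
          unfolding True last[OF v] by (simp add: v_def sum_negf)
        thus ?thesis using pc root True by (simp add: v_def)
      next
        case False
        thus ?thesis using upper[OF v, of i] i by (simp add: v_def)
      qed
    qed (use A v in auto)
    ultimately show "eigenvalue ?A x"
      using A v by (auto simp: eigenvalue_def eigenvector_def)
  qed
qed

section \<open>Linear functionals and Gauss quadrature\<close>

definition linear_functional :: "(real poly \<Rightarrow> real) \<Rightarrow> bool" where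
  "linear_functional L \<longleftrightarrow>
     (\<forall>P Q. L (P + Q) = L P + L Q) \<and> (\<forall>c P. L (Polynomial.smult c P) = c * L P)"

context
  fixes L :: "real poly \<Rightarrow> real"
  assumes L: "linear_functional L"
begin

lemma linear_functional_add: "L (P + Q) = L P + L Q"
  using L by (simp add: linear_functional_def)

lemma linear_functional_smult: "L (Polynomial.smult c P) = c * L P"
  using L by (simp add: linear_functional_def)

lemma linear_functional_0: "L 0 = 0"
  using linear_functional_smult[of 0 0] by simp

lemma linear_functional_diff: "L (P - Q) = L P - L Q"
  using linear_functional_add[of P "Polynomial.smult (-1) Q"] linear_functional_smult[of "-1" Q]
  by simp

lemma linear_functional_sum: "L (sum f A) = (\<Sum>x\<in>A. L (f x))"
  by (induction A rule: infinite_finite_induct)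
     (simp_all add: linear_functional_0 linear_functional_add)

lemma linear_functional_eq_coeff_sum:
  assumes "Polynomial.degree P \<le> n"
  shows "L P = (\<Sum>k\<le>n. Polynomial.coeff P k * L (Polynomial.monom 1 k))"
proof -
  have "P = (\<Sum>k\<le>n. Polynomial.smult (Polynomial.coeff P k) (Polynomial.monom 1 k))"
    using poly_as_sum_of_monoms'[OF assms] by (simp add: smult_monom)
  hence "L P = L (\<Sum>k\<le>n. Polynomial.smult (Polynomial.coeff P k) (Polynomial.monom 1 k))"
    by (rule arg_cong)
  thus ?thesis by (simp add: linear_functional_sum linear_functional_smult)
qed

end

lemma linear_functional_cong_degree:
  assumes "linear_functional K" "linear_functional L"
    and "\<And>k. k \<le> n \<Longrightarrow> K (Polynomial.monom 1 k) = L (Polynomial.monom 1 k)"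
    and "Polynomial.degree P \<le> n"
  shows "K P = L P"
  using assms by (simp add: linear_functional_eq_coeff_sum[where n = n])

definition lagrange :: "nat \<Rightarrow> (nat \<Rightarrow> real) \<Rightarrow> nat \<Rightarrow> real poly" where
  "lagrange n r i = Polynomial.smult (1 / (\<Prod>j\<in>{..<n} - {i}. r i - r j)) (\<Prod>j\<in>{..<n} - {i}. [:- r j, 1:])"

lemma degree_lagrange: "i < n \<Longrightarrow> Polynomial.degree (lagrange n r i) < n"
proof -
  assume i: "i < n"
  have "Polynomial.degree (\<Prod>j\<in>{..<n} - {i}. [:- r j, 1:]) = n - 1"
    using i by (subst degree_prod_eq_sum_degree) auto
  hence "Polynomial.degree (lagrange n r i) \<le> n - 1"
    unfolding lagrange_def by (metis degree_smult_le)
  with i show ?thesis by simp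
qed

lemma poly_lagrange:
  assumes "inj_on r {..<n}" "i < n" "k < n"
  shows "poly (lagrange n r i) (r k) = (if i = k then 1 else 0)"
proof (cases "i = k")
  case True
  have "(\<Prod>j\<in>{..<n} - {i}. r i - r j) \<noteq> 0"
    using assms by (auto simp: inj_on_eq_iff)
  thus ?thesis using True by (simp add: lagrange_def poly_prod)
next
  case False
  hence "(\<Prod>j\<in>{..<n} - {i}. r k - r j) = 0" using assms by (auto intro!: bexI[of _ k])
  thus ?thesis using False by (simp add: lagrange_def poly_prod)
qed

lemma lagrange_interpolation:
  assumes inj: "inj_on r {..<n}" and deg: "Polynomial.degree R < n"
  shows "R = (\<Sum>i<n. Polynomial.smult (poly R (r i)) (lagrange n r i))"
proof (rule poly_eqI_degree[where A = "r ` {..<n}"])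
  have card: "card (r ` {..<n}) = n" using inj by (simp add: card_image)
  show "poly R x = poly (\<Sum>i<n. Polynomial.smult (poly R (r i)) (lagrange n r i)) x"
    if "x \<in> r ` {..<n}" for x
  proof -
    from that obtain k where k: "k < n" "x = r k" by auto
    have "poly (\<Sum>i<n. Polynomial.smult (poly R (r i)) (lagrange n r i)) x =
        (\<Sum>i<n. if i = k then poly R (r k) else 0)"
      using k inj by (auto simp: poly_sum poly_lagrange simp del: sum.delta' sum.delta intro!: sum.cong)
    thus ?thesis using k by simp
  qed
  have "Polynomial.degree (\<Sum>i<n. Polynomial.smult (poly R (r i)) (lagrange n r i)) \<le> n - 1"
  proof (rule degree_sum_le)
    fix i assume "i \<in> {..<n}"
    hence "Polynomial.degree (lagrange n r i) \<le> n - 1" using degree_lagrange[of i n r] by simp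
    thus "Polynomial.degree (Polynomial.smult (poly R (r i)) (lagrange n r i)) \<le> n - 1"
      by (rule order.trans[OF degree_smult_le])
  qed simp
  thus "Polynomial.degree (\<Sum>i<n. Polynomial.smult (poly R (r i)) (lagrange n r i)) < card (r ` {..<n})"
    using deg card by linarith
  show "Polynomial.degree R < card (r ` {..<n})" using deg card by simp
qed

text \<open>
  Division by the node polynomial $p$ gives $P = pQ + R$, where $\deg Q \le n$. The functional kills
  $pQ$, and $R$ is recovered from its values at the nodes, which are those of $P$. Orthogonality is
  required up to degree $n$ and not only $n-1$, that is also $L(p^2) = 0$; this is why the formula is
  exact up to degree $2n$.
\<close>

lemma gauss_quadrature:
  assumes L: "linear_functional L" and inj: "inj_on r {..<n}" and n: "n > 0"
    and orth: "\<And>Q. Polynomial.degree Q \<le> n \<Longrightarrow> L (monic_with_roots n r * Q) = 0"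
    and deg: "Polynomial.degree P \<le> 2 * n"
  shows "L P = (\<Sum>i<n. L (lagrange n r i) * poly P (r i))"
proof -
  let ?p = "monic_with_roots n r"
  define Q R where "Q = P div ?p" and "R = P mod ?p"
  have p: "?p \<noteq> 0" by (metis monic_with_roots_coeff coeff_0 zero_neq_one)
  have PQR: "P = ?p * Q + R" by (simp add: Q_def R_def)
  have degR: "Polynomial.degree R < n"
    using degree_mod_less'[of ?p P] p n unfolding R_def by (cases "P mod ?p = 0") auto
  have "Polynomial.degree Q \<le> n"
  proof (cases "Q = 0")
    case False
    have "Polynomial.degree (?p * Q) = n + Polynomial.degree Q"
      using p False by (subst degree_mult_eq) auto
    moreover have "Polynomial.degree (P - R) \<le> 2 * n"
      using deg degR by (intro degree_diff_le) auto
    ultimately show ?thesis using PQR by (metis add_diff_cancel_right' add_le_cancel_left mult_2)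
  qed simp
  hence "L P = L R" by (simp add: PQR linear_functional_add[OF L] orth)
  also have "\<dots> = (\<Sum>i<n. poly R (r i) * L (lagrange n r i))"
    by (subst lagrange_interpolation[OF inj degR])
       (simp only: linear_functional_sum[OF L] linear_functional_smult[OF L])
  also have "\<dots> = (\<Sum>i<n. L (lagrange n r i) * poly P (r i))"
    by (intro sum.cong) (auto simp: PQR)
  finally show ?thesis .
qed

section \<open>The closure is well defined\<close>

text \<open>
  For $t > 0$ this is the average of $P$ against the mixture $\sum_i w_i \mathcal{N}(u_i, t)$, for $t = 0$
  against the atoms $\sum_i w_i \delta_{u_i}$. Negative $t$ arises when the flow of a variance larger
  than the actual one is undone.
\<close>

definition mixture :: "nat \<Rightarrow> (nat \<Rightarrow> real) \<Rightarrow> (nat \<Rightarrow> real) \<Rightarrow> real \<Rightarrow> real poly \<Rightarrow> real" where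
  "mixture n w u t P = (\<Sum>i<n. w i * poly (heat t P) (u i))"

lemma linear_functional_mixture: "linear_functional (mixture n w u t)"
  by (simp add: linear_functional_def mixture_def heat_add heat_smult algebra_simps
      sum.distrib sum_distrib_left)

lemma mixture_heat: "mixture n w u t (heat s P) = mixture n w u (t + s) P"
  by (simp add: mixture_def heat_heat)

lemma mixture_zero_time: "mixture n w u 0 P = (\<Sum>i<n. w i * poly P (u i))"
  by (simp add: mixture_def)

lemma moment_eq_mixture:
  assumes "sigma2 N W > 0"
  shows "moment N W j = mixture N (weight W) (node W) (sigma2 N W) (Polynomial.monom 1 j)"
  using assms by (simp add: moment_def mixture_def gauss_moment_eq_heat)

text \<open>
  Undoing the flow for the smaller time $t$ turns the first functional into a sum of atoms, which
  kills $p^2$ for the node polynomial $p$. If $t' > t$, the second functional would still average with a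
  Gaussian and be positive on $p^2$; hence $t = t'$. Then $p$ vanishes at the nodes of the
  second functional as well, so that both kill $x p^2$ after the flow is undone. This
  polynomial has degree $2n+1$, hence agreement up to degree $2n$ extends by one degree.
\<close>

lemma mixture_determined_ordered:
  fixes n :: nat and w u w' u' :: "nat \<Rightarrow> real"
  assumes n: "n > 0" and le: "t \<le> t'"
    and w: "\<And>i. i < n \<Longrightarrow> w i > 0" "\<And>i. i < n \<Longrightarrow> w' i > 0"
    and eq: "\<And>P. Polynomial.degree P \<le> 2 * n \<Longrightarrow> mixture n w u t P = mixture n w' u' t' P"
    and deg: "Polynomial.degree P = 2 * n + 1"
  shows "mixture n w u t P = mixture n w' u' t' P"
proof -
  let ?p = "monic_with_roots n u"
  let ?K = "mixture n w u t" and ?K' = "mixture n w' u' t'"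
  have p: "?p \<noteq> 0" by (metis monic_with_roots_coeff coeff_0 zero_neq_one)
  have deg_pp: "Polynomial.degree (?p * ?p) = 2 * n"
    using p by (subst degree_mult_eq) auto
  have "mixture n w u 0 (?p * ?p) = ?K (heat (- t) (?p * ?p))"
    by (simp add: mixture_heat)
  also have "\<dots> = ?K' (heat (- t) (?p * ?p))" by (rule eq) (simp add: deg_pp)
  finally have "?K' (heat (- t) (?p * ?p)) = 0" by (simp add: mixture_zero_time)
  hence zero: "mixture n w' u' (t' - t) (?p * ?p) = 0" by (simp add: mixture_heat)
  have tt: "t = t'"
  proof (rule ccontr)
    assume "t \<noteq> t'"
    hence t: "t' - t > 0" using le by simp
    have "mixture n w' u' (t' - t) (?p * ?p) > 0"
      unfolding mixture_def using w p n
      by (intro sum_pos mult_pos_pos poly_heat_pos[OF t]) auto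
    with zero show False by simp
  qed
  have roots: "poly ?p (u' i) = 0" if i: "i < n" for i
  proof -
    have "(\<Sum>i<n. w' i * (poly ?p (u' i))\<^sup>2) = 0"
      using zero unfolding tt by (simp add: mixture_zero_time power2_eq_square)
    hence "w' i * (poly ?p (u' i))\<^sup>2 = 0"
      using i w(2) by (subst (asm) sum_nonneg_eq_0_iff) (auto simp: zero_le_mult_iff less_imp_le)
    thus ?thesis using w(2)[OF i] by simp
  qed
  \<comment> \<open>Killed by both functionals, and of the same leading coefficient as \<open>P\<close>.\<close>
  define C where "C = Polynomial.smult (lead_coeff P) (heat (- t) ([:0, 1:] * (?p * ?p)))"
  have K: "?K C = 0" "?K' C = 0"
    unfolding C_def
    by (simp_all add: linear_functional_smult[OF linear_functional_mixture] mixture_heat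
        mixture_zero_time tt roots del: mult_pCons_left)
  have degX: "Polynomial.degree ([:0, 1:] * (?p * ?p)) = 2 * n + 1"
    using p deg_pp by (subst degree_mult_eq) auto
  have "lead_coeff ([:0, 1:] * (?p * ?p)) = 1"
    unfolding lead_coeff_mult by simp
  hence "Polynomial.coeff C (2 * n + 1) = lead_coeff P"
    using lead_coeff_heat[of "- t" "[:0, 1:] * (?p * ?p)"] degX
    by (simp add: C_def del: mult_pCons_left)
  moreover have C_deg: "Polynomial.degree C \<le> 2 * n + 1"
    unfolding C_def using degX by (intro order.trans[OF degree_smult_le]) (simp only: degree_heat)
  ultimately have coeff: "Polynomial.coeff (P - C) (2 * n + 1) = 0"
    using deg by simp
  have "Polynomial.degree (P - C) \<le> 2 * n"
  proof (rule degree_le, intro allI impI)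
    fix i assume "2 * n < i"
    hence "i = 2 * n + 1 \<or> i > 2 * n + 1" by linarith
    thus "Polynomial.coeff (P - C) i = 0"
      using coeff C_deg deg by (auto simp: coeff_eq_0)
  qed
  hence "?K (P - C) = ?K' (P - C)" by (rule eq)
  thus ?thesis by (simp add: linear_functional_diff[OF linear_functional_mixture] K)
qed

lemma mixture_determined:
  fixes n :: nat and w u w' u' :: "nat \<Rightarrow> real"
  assumes n: "n > 0"
    and w: "\<And>i. i < n \<Longrightarrow> w i > 0" "\<And>i. i < n \<Longrightarrow> w' i > 0"
    and eq: "\<And>k. k \<le> 2 * n \<Longrightarrow>
      mixture n w u t (Polynomial.monom 1 k) = mixture n w' u' t' (Polynomial.monom 1 k)"
    and deg: "Polynomial.degree P = 2 * n + 1"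
  shows "mixture n w u t P = mixture n w' u' t' P"
proof -
  have eq': "mixture n w u t P = mixture n w' u' t' P" if "Polynomial.degree P \<le> 2 * n" for P
    using linear_functional_mixture linear_functional_mixture eq that
    by (rule linear_functional_cong_degree)
  show ?thesis
  proof (cases "t \<le> t'")
    case True
    show ?thesis by (rule mixture_determined_ordered[OF n True w eq' deg])
  next
    case False
    hence "t' \<le> t" by simp
    from mixture_determined_ordered[OF n this w(2) w(1) eq'[symmetric] deg] show ?thesis by simp
  qed
qed

lemma moment_map_eq_iff:
  "moment_map N W = moment_map N W' \<longleftrightarrow> (\<forall>k\<le>2 * N. moment N W k = moment N W' k)"
  by (auto simp: moment_map_def vec_eq_iff less_Suc_eq_le)

lemma Mbar_moment_map:
  assumes N: "N > 0" and W: "W \<in> Omega_open N"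
  shows "Mbar N (moment_map N W) = moment N W (2 * N + 1)"
proof -
  define W' where "W' = (SOME V. V \<in> Omega_open N \<and> moment_map N V = moment_map N W)"
  have W': "W' \<in> Omega_open N" "moment_map N W' = moment_map N W"
    using someI[of "\<lambda>V. V \<in> Omega_open N \<and> moment_map N V = moment_map N W" W] W
    by (auto simp: W'_def)
  have pos: "sigma2 N W > 0" "sigma2 N W' > 0" using W W' by (auto simp: Omega_open_def)
  have "moment N W' (2 * N + 1) = moment N W (2 * N + 1)"
    unfolding moment_eq_mixture[OF pos(1)] moment_eq_mixture[OF pos(2)]
  proof (rule mixture_determined[OF N])
    show "weight W' i > 0" "weight W i > 0" if "i < N" for i
      using W W' that by (auto simp: Omega_open_def)
    show "mixture N (weight W') (node W') (sigma2 N W') (Polynomial.monom 1 k) =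
        mixture N (weight W) (node W) (sigma2 N W) (Polynomial.monom 1 k)" if "k \<le> 2 * N" for k
      using W'(2) that pos by (simp add: moment_map_eq_iff moment_eq_mixture)
  qed (simp add: degree_monom_eq)
  thus ?thesis by (simp add: Mbar_def W'_def)
qed

section \<open>Small perturbations\<close>

lemma isCont_coeff_heat: "isCont (\<lambda>s. Polynomial.coeff (heat s P) m) x"
  unfolding heat_def coeff_sum coeff_smult by (intro continuous_intros) auto

lemma isCont_poly_heat: "isCont (\<lambda>s. poly (heat s P) y) x"
  unfolding heat_def poly_sum poly_smult by (intro continuous_intros) auto

text \<open>
  Expansion to second order in time. The generator of the flow is $D^2/2$, and the remainder is a
  polynomial in the time as well.
\<close>

lemma poly_heat_expansion:
  obtains g where "isCont g 0"
    and "\<And>s. poly (heat s P) y = poly P y + s / 2 * poly (pderiv (pderiv P)) y + s\<^sup>2 * g s"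
proof
  define d where "d = Polynomial.degree P"
  define a where "a k = poly ((pderiv ^^ (2 * k)) P) y / fact k" for k
  define g where "g s = (\<Sum>k\<le>d. (s / 2) ^ k / 4 * a (Suc (Suc k)))" for s
  show "isCont g 0" unfolding g_def by (intro continuous_intros) auto
  show "poly (heat s P) y = poly P y + s / 2 * poly (pderiv (pderiv P)) y + s\<^sup>2 * g s" for s
  proof -
    have "poly (heat s P) y = (\<Sum>k\<le>Suc (Suc d). (s / 2) ^ k * a k)"
      by (subst heat_eq_sum[where n = "Suc (Suc d)"]) (simp_all add: d_def a_def poly_sum)
    also have "\<dots> = a 0 + s / 2 * a 1 + (\<Sum>k\<le>d. (s / 2) ^ Suc (Suc k) * a (Suc (Suc k)))"
      by (subst sum.atMost_Suc_shift, subst sum.atMost_Suc_shift) simp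
    also have "(\<Sum>k\<le>d. (s / 2) ^ Suc (Suc k) * a (Suc (Suc k))) = s\<^sup>2 * g s"
      unfolding g_def sum_distrib_left by (intro sum.cong) (simp_all add: power2_eq_square)
    also have "a 0 = poly P y" by (simp add: a_def)
    also have "a 1 = poly (pderiv (pderiv P)) y" by (simp add: a_def numeral_2_eq_2)
    finally show ?thesis by simp
  qed
qed

lemma tendsto_det:
  fixes A :: "'b \<Rightarrow> real mat"
  assumes "\<And>x. A x \<in> carrier_mat n n" "B \<in> carrier_mat n n"
    and "\<And>i k. i < n \<Longrightarrow> k < n \<Longrightarrow> ((\<lambda>x. A x $$ (i, k)) \<longlongrightarrow> B $$ (i, k)) F"
  shows "((\<lambda>x. Determinant.det (A x)) \<longlongrightarrow> Determinant.det B) F"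
proof -
  have "((\<lambda>x. \<Sum>p\<in>{p. p permutes {0..<n}}. signof p * (\<Prod>i = 0..<n. A x $$ (i, p i))) \<longlongrightarrow>
      (\<Sum>p\<in>{p. p permutes {0..<n}}. signof p * (\<Prod>i = 0..<n. B $$ (i, p i)))) F"
  proof (intro tendsto_sum tendsto_mult tendsto_const tendsto_prod)
    fix p i assume "p \<in> {p. p permutes {0..<n}}" "i \<in> {0..<n}"
    hence "p i \<in> {0..<n}" "i < n" using permutes_in_image[of p "{0..<n}" i] by auto
    thus "((\<lambda>x. A x $$ (i, p i)) \<longlongrightarrow> B $$ (i, p i)) F" using assms(3) by auto
  qed
  thus ?thesis unfolding det_def'[OF assms(1)] det_def'[OF assms(2)] .
qed

text \<open>
  The off-diagonal part is estimated with $2 |x_i x_k| \le x_i^2 + x_k^2$ and uses up at most half of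
  the diagonal.
\<close>

lemma quadratic_form_diagonally_dominant:
  fixes a :: "nat \<Rightarrow> nat \<Rightarrow> real" and \<eta> :: real
  assumes close: "\<And>i k. i < n \<Longrightarrow> k < n \<Longrightarrow> \<bar>a i k - (if i = k then w i else 0)\<bar> \<le> \<eta>"
    and w: "\<And>i. i < n \<Longrightarrow> w i \<ge> 2 * real n * \<eta>"
  shows "(\<Sum>i<n. \<Sum>k<n. x i * x k * a i k) \<ge> n * \<eta> * (\<Sum>i<n. (x i)\<^sup>2)"
proof -
  have summand: "x i * x k * a i k \<ge> (if i = k then w i * (x i)\<^sup>2 else 0) - \<eta> / 2 * ((x i)\<^sup>2 + (x k)\<^sup>2)"
    if "i < n" "k < n" for i k
  proof -
    let ?b = "a i k - (if i = k then w i else 0)"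
    have "\<bar>x i * x k * ?b\<bar> = \<bar>x i * x k\<bar> * \<bar>?b\<bar>" by (simp only: abs_mult)
    also have "\<dots> \<le> \<bar>x i * x k\<bar> * \<eta>" using close[OF that] by (intro mult_left_mono) auto
    also have "\<dots> \<le> ((x i)\<^sup>2 + (x k)\<^sup>2) / 2 * \<eta>"
    proof (rule mult_right_mono)
      have "(\<bar>x i\<bar> - \<bar>x k\<bar>)\<^sup>2 \<ge> 0" by simp
      thus "\<bar>x i * x k\<bar> \<le> ((x i)\<^sup>2 + (x k)\<^sup>2) / 2"
        by (simp add: power2_diff abs_mult)
      show "\<eta> \<ge> 0" using close[OF that] by linarith
    qed
    finally have "x i * x k * ?b \<ge> - (((x i)\<^sup>2 + (x k)\<^sup>2) / 2 * \<eta>)" by linarith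
    moreover have "x i * x k * a i k = (if i = k then w i * (x i)\<^sup>2 else 0) + x i * x k * ?b"
      by (simp add: algebra_simps power2_eq_square)
    moreover have "((x i)\<^sup>2 + (x k)\<^sup>2) / 2 * \<eta> = \<eta> / 2 * ((x i)\<^sup>2 + (x k)\<^sup>2)" by simp
    ultimately show ?thesis by linarith
  qed
  have "(\<Sum>i<n. \<Sum>k<n. x i * x k * a i k) \<ge>
      (\<Sum>i<n. \<Sum>k<n. (if i = k then w i * (x i)\<^sup>2 else 0) - \<eta> / 2 * ((x i)\<^sup>2 + (x k)\<^sup>2))"
    by (intro sum_mono summand) auto
  also have "(\<Sum>i<n. \<Sum>k<n. (if i = k then w i * (x i)\<^sup>2 else 0) - \<eta> / 2 * ((x i)\<^sup>2 + (x k)\<^sup>2)) =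
      (\<Sum>i<n. w i * (x i)\<^sup>2) - n * \<eta> * (\<Sum>i<n. (x i)\<^sup>2)"
  proof -
    have "(\<Sum>i<n. \<Sum>k<n. (x i)\<^sup>2 + (x k)\<^sup>2) = 2 * real n * (\<Sum>i<n. (x i)\<^sup>2)"
      by (simp add: sum.distrib flip: sum_distrib_left)
    moreover have "(\<Sum>i<n. \<Sum>k<n. \<eta> / 2 * ((x i)\<^sup>2 + (x k)\<^sup>2)) =
        \<eta> / 2 * (\<Sum>i<n. \<Sum>k<n. (x i)\<^sup>2 + (x k)\<^sup>2)"
      by (simp only: sum_distrib_left)
    ultimately show ?thesis by (simp add: sum_subtractf)
  qed
  finally have "(\<Sum>i<n. \<Sum>k<n. x i * x k * a i k) \<ge>
      (\<Sum>i<n. w i * (x i)\<^sup>2) - n * \<eta> * (\<Sum>i<n. (x i)\<^sup>2)" .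
  moreover have "(\<Sum>i<n. w i * (x i)\<^sup>2) \<ge> (\<Sum>i<n. 2 * real n * \<eta> * (x i)\<^sup>2)"
    using w by (intro sum_mono mult_right_mono) auto
  ultimately show ?thesis by (simp add: sum_distrib_left[symmetric])
qed

lemma finite_points_separated:
  fixes u :: "nat \<Rightarrow> real"
  assumes "inj_on u {..<n}"
  obtains \<epsilon> where "\<epsilon> > 0" "\<And>i j. i < n \<Longrightarrow> j < n \<Longrightarrow> i \<noteq> j \<Longrightarrow> \<bar>u i - u j\<bar> > 2 * \<epsilon>"
proof -
  \<comment> \<open>The element 1 keeps the set nonempty when there is a single node.\<close>
  define D where "D = insert 1 ((\<lambda>(i, j). \<bar>u i - u j\<bar>) ` ({..<n} \<times> {..<n} - Id))"
  have fin: "finite D" by (simp add: D_def)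
  have "d > 0" if "d \<in> D" for d
    using that assms by (auto simp: D_def inj_on_eq_iff)
  hence pos: "Min D > 0" using fin by (subst Min_gr_iff) (auto simp: D_def)
  show ?thesis
  proof (rule that[of "Min D / 3"])
    fix i j assume "i < n" "j < n" "i \<noteq> j"
    hence "\<bar>u i - u j\<bar> \<in> D" by (force simp: D_def)
    hence "Min D \<le> \<bar>u i - u j\<bar>" using fin by simp
    thus "\<bar>u i - u j\<bar> > 2 * (Min D / 3)" using pos by linarith
  qed (use pos in simp)
qed

text \<open>
  The unperturbed polynomial changes sign at each $u_i$, between two points $u_i \pm \epsilon$ whose
  distance separates the nodes. The signs at these finitely many points survive a small perturbation,
  so one root stays near each node.
\<close>

lemma eventually_perturbed_real_roots:
  fixes c :: "'b \<Rightarrow> nat \<Rightarrow> real"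
  assumes inj: "inj_on u {..<n}"
    and c: "\<And>k. k < n \<Longrightarrow> ((\<lambda>e. c e k) \<longlongrightarrow> 0) F"
  shows "eventually (\<lambda>e. \<exists>r. inj_on r {..<n} \<and>
    monic_with_roots n u + (\<Sum>k<n. Polynomial.smult (c e k) (lagrange n u k)) = monic_with_roots n r) F"
proof -
  define p where "p e = monic_with_roots n u + (\<Sum>k<n. Polynomial.smult (c e k) (lagrange n u k))" for e
  obtain \<epsilon> where \<epsilon>: "\<epsilon> > 0" "\<And>i j. i < n \<Longrightarrow> j < n \<Longrightarrow> i \<noteq> j \<Longrightarrow> \<bar>u i - u j\<bar> > 2 * \<epsilon>"
    using finite_points_separated[OF inj] by blast
  have lim: "((\<lambda>e. poly (p e) x) \<longlongrightarrow> poly (monic_with_roots n u) x) F" for x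
  proof -
    have "((\<lambda>e. poly (monic_with_roots n u) x + (\<Sum>k<n. c e k * poly (lagrange n u k) x))
        \<longlongrightarrow> poly (monic_with_roots n u) x + (\<Sum>k<n. 0 * poly (lagrange n u k) x)) F"
      using c by (intro tendsto_intros) auto
    thus ?thesis by (simp add: p_def poly_sum)
  qed
  have neg: "poly (monic_with_roots n u) (u i - \<epsilon>) * poly (monic_with_roots n u) (u i + \<epsilon>) < 0"
    if i: "i < n" for i
  proof -
    have "poly (monic_with_roots n u) (u i - \<epsilon>) * poly (monic_with_roots n u) (u i + \<epsilon>) =
        (\<Prod>j<n. (u i - \<epsilon> - u j) * (u i + \<epsilon> - u j))"
      by (simp add: poly_monic_with_roots prod.distrib)
    also have "\<dots> = (\<Prod>j<n. (u i - u j)\<^sup>2 - \<epsilon>\<^sup>2)"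
      by (intro prod.cong) (auto simp: power2_eq_square algebra_simps)
    also have "\<dots> = - \<epsilon>\<^sup>2 * (\<Prod>j\<in>{..<n} - {i}. (u i - u j)\<^sup>2 - \<epsilon>\<^sup>2)"
      using i by (subst prod.remove[of _ i]) auto
    also have "\<dots> < 0"
    proof (rule mult_neg_pos)
      show "(\<Prod>j\<in>{..<n} - {i}. (u i - u j)\<^sup>2 - \<epsilon>\<^sup>2) > 0"
      proof (rule prod_pos)
        fix j assume "j \<in> {..<n} - {i}"
        hence "\<epsilon> < \<bar>u i - u j\<bar>" using \<epsilon>(2)[of i j] i \<epsilon>(1) by auto
        hence "\<epsilon>\<^sup>2 < \<bar>u i - u j\<bar>\<^sup>2" using \<epsilon>(1) by (intro power_strict_mono) auto
        thus "0 < (u i - u j)\<^sup>2 - \<epsilon>\<^sup>2" by simp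
      qed
    qed (use \<epsilon>(1) in simp)
    finally show ?thesis .
  qed
  have "eventually (\<lambda>e. \<forall>i\<in>{..<n}. poly (p e) (u i - \<epsilon>) * poly (p e) (u i + \<epsilon>) < 0) F"
    by (rule eventually_ball_finite)
       (use neg order_tendstoD(2)[OF tendsto_mult[OF lim lim]] in auto)
  thus ?thesis
  proof eventually_elim
    case (elim e)
    have "\<exists>r. u i - \<epsilon> < r \<and> r < u i + \<epsilon> \<and> poly (p e) r = 0" if "i < n" for i
      using poly_IVT[of "u i - \<epsilon>" "u i + \<epsilon>" "p e"] elim that \<epsilon>(1) by force
    then obtain r where r: "\<And>i. i < n \<Longrightarrow> u i - \<epsilon> < r i \<and> r i < u i + \<epsilon> \<and> poly (p e) (r i) = 0"
      by metis
    have inj_r: "inj_on r {..<n}"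
    proof (rule inj_onI, rule ccontr)
      fix i j assume "i \<in> {..<n}" "j \<in> {..<n}" "r i = r j" "i \<noteq> j"
      thus False using \<epsilon>(2)[of i j] r[of i] r[of j] by auto
    qed
    have "p e = monic_with_roots n r"
    proof (rule poly_eqI_degree_lead_coeff[where n = n and A = "r ` {..<n}"])
      have lag: "Polynomial.coeff (lagrange n u k) n = 0" "Polynomial.degree (lagrange n u k) \<le> n"
        if "k < n" for k
        using degree_lagrange[OF that, of u] by (auto simp: coeff_eq_0)
      show "Polynomial.coeff (p e) n = Polynomial.coeff (monic_with_roots n r) n"
        using lag by (simp add: p_def coeff_sum)
      show "Polynomial.degree (p e) \<le> n"
        unfolding p_def using lag
        by (intro degree_add_le degree_sum_le) (auto intro: order.trans[OF degree_smult_le])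
      show "poly (p e) z = poly (monic_with_roots n r) z" if "z \<in> r ` {..<n}" for z
        using that r by auto
    qed (use inj_r in \<open>auto simp: card_image\<close>)
    with inj_r show ?case by (auto simp: p_def)
  qed
qed

lemma mixture_expansion:
  obtains G where "isCont G 0"
    and "\<And>s. mixture n w u s P = mixture n w u 0 P + s / 2 * mixture n w u 0 (pderiv (pderiv P)) + s\<^sup>2 * G s"
proof -
  have "\<exists>g. isCont g 0 \<and> (\<forall>s. poly (heat s P) (u i) =
      poly P (u i) + s / 2 * poly (pderiv (pderiv P)) (u i) + s\<^sup>2 * g s)" for i
    using poly_heat_expansion[of P "u i"] by metis
  then obtain g where g: "\<And>i. isCont (g i) 0"
    "\<And>i s. poly (heat s P) (u i) = poly P (u i) + s / 2 * poly (pderiv (pderiv P)) (u i) + s\<^sup>2 * g i s"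
    by metis
  show ?thesis
  proof
    show "isCont (\<lambda>s. \<Sum>i<n. w i * g i s) 0" using g(1) by (intro continuous_intros)
    show "mixture n w u s P = mixture n w u 0 P + s / 2 * mixture n w u 0 (pderiv (pderiv P)) +
        s\<^sup>2 * (\<Sum>i<n. w i * g i s)" for s
      by (simp add: mixture_def g(2) algebra_simps sum.distrib sum_distrib_left sum_divide_distrib)
  qed
qed

lemma tendsto_bounded_times_null:
  fixes y f :: "'b \<Rightarrow> real"
  assumes "\<And>x. \<bar>y x\<bar> \<le> C" "(f \<longlongrightarrow> 0) F"
  shows "((\<lambda>x. y x * f x) \<longlongrightarrow> 0) F"
proof (rule Lim_null_comparison)
  show "((\<lambda>x. C * \<bar>f x\<bar>) \<longlongrightarrow> 0) F"
    using tendsto_mult[OF tendsto_const[of C] tendsto_rabs_zero[OF assms(2)]] by simp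
  show "eventually (\<lambda>x. norm (y x * f x) \<le> C * \<bar>f x\<bar>) F"
    using assms(1) by (intro always_eventually allI) (simp add: abs_mult mult_right_mono)
qed

section \<open>Changing a single moment\<close>

text \<open>
  A mixture of variance \<open>t0\<close> together with the index \<open>m\<close> of the moment that is changed.
\<close>

locale perturbed_mixture =
  fixes n :: nat and w u :: "nat \<Rightarrow> real" and t0 :: real and m :: nat
  assumes n_pos: "n > 0"
    and w_pos: "\<And>i. i < n \<Longrightarrow> w i > 0"
    and inj_u: "inj_on u {..<n}"
begin

text \<open>
  The functional that belongs to the moments with the $m$-th one increased by $e$, after the heat flow
  of the tentative variance $t_0 + s$ has been undone. The perturbed moments come from a mixture
  of that variance, if it is positive, exactly if $L$ is given on degree at most $2n$ by $n$ atoms of positive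
  weight. At $e = s = 0$ it is \<open>L0\<close>, the sum over the original atoms.
\<close>

definition L :: "real \<Rightarrow> real \<Rightarrow> real poly \<Rightarrow> real" where
  "L e s P = mixture n w u (- s) P + e * Polynomial.coeff (heat (- t0 - s) P) m"

lemma linear_functional_L: "linear_functional (L e s)"
  by (simp add: linear_functional_def L_def heat_add heat_smult algebra_simps
      linear_functional_add[OF linear_functional_mixture]
      linear_functional_smult[OF linear_functional_mixture])

lemmas L_add = linear_functional_add[OF linear_functional_L]
  and L_smult = linear_functional_smult[OF linear_functional_L]
  and L_diff = linear_functional_diff[OF linear_functional_L]
  and L_sum = linear_functional_sum[OF linear_functional_L]

abbreviation L0 :: "real poly \<Rightarrow> real" where "L0 \<equiv> mixture n w u 0"

lemma L_tendsto:
  assumes "(f \<longlongrightarrow> 0) F" "(s \<longlongrightarrow> 0) F"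
  shows "((\<lambda>x. L (f x) (s x) P) \<longlongrightarrow> L0 P) F"
proof -
  have "((\<lambda>x. - s x) \<longlongrightarrow> 0) F" "((\<lambda>x. - t0 - s x) \<longlongrightarrow> - t0) F"
    using assms(2) by (auto intro!: tendsto_eq_intros)
  note lims = isCont_tendsto_compose[OF isCont_poly_heat this(1)]
    isCont_tendsto_compose[OF isCont_coeff_heat this(2)]
  have "((\<lambda>x. L (f x) (s x) P) \<longlongrightarrow>
      (\<Sum>i<n. w i * poly (heat 0 P) (u i)) + 0 * Polynomial.coeff (heat (- t0) P) m) F"
    unfolding L_def mixture_def
    by (intro tendsto_add tendsto_sum tendsto_mult tendsto_const assms(1) lims)
  thus ?thesis by (simp add: mixture_def)
qed

text \<open>
  The first order behaviour of \<open>L\<close>. The variance is shifted by $s = y e$ with bounded $y$, so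
  that it moves at the same rate as the moment. The term with $y$ on the left is the effect of the variance,
  the limit is that of the moment.
\<close>

lemma L_quotient_tendsto:
  assumes y: "\<And>e. \<bar>y e\<bar> \<le> C" and P: "L0 P = 0"
  shows "((\<lambda>e. L e (y e * e) P / e + y e / 2 * L0 (pderiv (pderiv P)))
    \<longlongrightarrow> Polynomial.coeff (heat (- t0) P) m) (at 0)"
proof -
  define s where "s e = y e * e" for e
  have s: "(s \<longlongrightarrow> 0) (at 0)"
    unfolding s_def by (rule tendsto_bounded_times_null[OF y tendsto_ident_at])
  obtain G where G: "isCont G 0"
    and expand: "\<And>s. mixture n w u s P = L0 P + s / 2 * L0 (pderiv (pderiv P)) + s\<^sup>2 * G s"
    using mixture_expansion[of n w u P] by blast
  have "((\<lambda>e. - s e) \<longlongrightarrow> 0) (at 0)" "((\<lambda>e. - t0 - s e) \<longlongrightarrow> - t0) (at 0)"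
    using s by (auto intro!: tendsto_eq_intros)
  note lims = isCont_tendsto_compose[OF G this(1)] isCont_tendsto_compose[OF isCont_coeff_heat this(2)]
  have "((\<lambda>e. s e * G (- s e)) \<longlongrightarrow> 0) (at 0)"
    using tendsto_mult[OF s lims(1)] by simp
  note tendsto_bounded_times_null[OF y this]
  from tendsto_add[OF this lims(2)]
  have "((\<lambda>e. y e * (s e * G (- s e)) + Polynomial.coeff (heat (- t0 - s e) P) m)
      \<longlongrightarrow> Polynomial.coeff (heat (- t0) P) m) (at 0)" by simp
  moreover have "eventually (\<lambda>e. y e * (s e * G (- s e)) + Polynomial.coeff (heat (- t0 - s e) P) m =
      L e (y e * e) P / e + y e / 2 * L0 (pderiv (pderiv P))) (at 0)"
  proof (rule eventually_mono[rotated])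
    show "eventually (\<lambda>e::real. e \<noteq> 0) (at 0)" by (simp add: eventually_at_filter)
    fix e :: real assume "e \<noteq> 0"
    thus "y e * (s e * G (- s e)) + Polynomial.coeff (heat (- t0 - s e) P) m =
      L e (y e * e) P / e + y e / 2 * L0 (pderiv (pderiv P))"
      unfolding L_def expand[of "- (y e * e)"] P
      by (simp add: s_def field_simps power2_eq_square)
  qed
  ultimately show ?thesis by (rule Lim_transform_eventually)
qed

text \<open>
  Polynomials of degree at most $n$, in coordinates adapted to the original nodes: with respect to
  \<open>L0\<close> this basis is orthogonal, and its last element, the node polynomial, is a null vector.
\<close>

definition basis :: "nat \<Rightarrow> real poly" where
  "basis k = (if k < n then lagrange n u k else monic_with_roots n u)"

lemma L0_lagrange_mult:
  assumes "i < n"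
  shows "L0 (lagrange n u i * P) = w i * poly P (u i)"
proof -
  have "L0 (lagrange n u i * P) = (\<Sum>k<n. if i = k then w i * poly P (u i) else 0)"
    unfolding mixture_zero_time
    using assms by (intro sum.cong) (auto simp: poly_lagrange[OF inj_u])
  thus ?thesis using assms by simp
qed

lemma L0_node_mult: "L0 (monic_with_roots n u * P) = 0"
  by (simp add: mixture_zero_time)

text \<open>
  The Gram matrix of \<open>L\<close>, with its last row divided by $e$ because that row is of order $e$. For nonzero
  $e$ the null vectors are the same, and in the limit $e \to 0$ the condition that one exists can be
  solved for the rate \<open>y\<close>.
\<close>

definition gram :: "real \<Rightarrow> real \<Rightarrow> real mat" where
  "gram e y = Matrix.mat (n + 1) (n + 1)
     (\<lambda>(i, k). L e (y * e) (basis i * basis k) / (if i = n then e else 1))"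

lemma gram_carrier: "gram e y \<in> carrier_mat (n + 1) (n + 1)"
  by (simp add: gram_def)

text \<open>
  The rate at which a larger assumed variance lowers $L(p^2)$ for the node polynomial $p$: the
  quantity $\frac{1}{2} L_0((p^2)'')$.
\<close>

definition kappa :: real where "kappa = (\<Sum>i<n. w i * (poly (pderiv (monic_with_roots n u)) (u i))\<^sup>2)"

lemma kappa_gt_0: "kappa > 0"
proof -
  have "poly (pderiv (monic_with_roots n u)) (u i) \<noteq> 0" if "i < n" for i
    using that inj_u by (subst poly_pderiv_monic_with_roots) (auto simp: inj_on_eq_iff)
  thus ?thesis unfolding kappa_def using n_pos w_pos by (intro sum_pos) auto
qed

lemma L0_pderiv2_node_square:
  "L0 (pderiv (pderiv (monic_with_roots n u * monic_with_roots n u))) = 2 * kappa"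
  unfolding mixture_zero_time kappa_def sum_distrib_left
  by (intro sum.cong)
     (simp_all add: pderiv_mult pderiv_add power2_eq_square algebra_simps del: pderiv_prod)

text \<open>
  In the limit the matrix is lower triangular, and only its last diagonal entry depends on $y$.
\<close>

lemma det_gram_tendsto:
  obtains b where "\<And>y. ((\<lambda>e. Determinant.det (gram e y)) \<longlongrightarrow> (\<Prod>i<n. w i) * (b - y * kappa)) (at 0)"
proof -
  define b where "b k = Polynomial.coeff (heat (- t0) (basis n * basis k)) m" for k
  have "((\<lambda>e. Determinant.det (gram e y)) \<longlongrightarrow> (\<Prod>i<n. w i) * (b n - y * kappa)) (at 0)" for y
  proof -
    define c where "c k = b k - y / 2 * L0 (pderiv (pderiv (basis n * basis k)))" for k
    define B where "B = Matrix.mat (n + 1) (n + 1)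
        (\<lambda>(i, k). if i = n then c k else if i = k then w i else 0)"
    have B: "B \<in> carrier_mat (n + 1) (n + 1)" by (simp add: B_def)
    have "((\<lambda>e. Determinant.det (gram e y)) \<longlongrightarrow> Determinant.det B) (at 0)"
    proof (rule tendsto_det[OF gram_carrier B])
      fix i k assume ik: "i < n + 1" "k < n + 1"
      show "((\<lambda>e. gram e y $$ (i, k)) \<longlongrightarrow> B $$ (i, k)) (at 0)"
      proof (cases "i = n")
        case True
        have "L0 (basis n * basis k) = 0" by (simp add: basis_def L0_node_mult)
        from L_quotient_tendsto[of "\<lambda>_. y" "\<bar>y\<bar>", OF order.refl this]
        have "((\<lambda>e. L e (y * e) (basis n * basis k) / e) \<longlongrightarrow> c k) (at 0)"
          unfolding c_def b_def
          by (drule_tac tendsto_diff[OF _ tendsto_const[of "y / 2 * L0 (pderiv (pderiv (basis n * basis k)))"]]) simp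
        thus ?thesis using True ik by (simp add: gram_def B_def)
      next
        case False
        hence i: "i < n" using ik by simp
        have "((\<lambda>e. L e (y * e) (basis i * basis k)) \<longlongrightarrow> L0 (basis i * basis k)) (at 0)"
          by (rule L_tendsto) (auto intro!: tendsto_eq_intros)
        moreover have "L0 (basis i * basis k) = (if i = k then w i else 0)"
          using i ik
          by (auto simp: basis_def L0_lagrange_mult poly_lagrange[OF inj_u])
        ultimately show ?thesis using False ik by (simp add: gram_def B_def)
      qed
    qed
    moreover have "Determinant.det B = prod_list (diag_mat B)"
      by (rule det_lower_triangular[OF _ B]) (auto simp: B_def)
    moreover have "diag_mat B = map w [0..<n] @ [c n]"
      by (auto simp: diag_mat_def B_def)
    moreover have "prod_list (map w [0..<n]) = (\<Prod>i<n. w i)"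
      by (simp add: prod.distinct_set_conv_list[symmetric] atLeast0LessThan)
    moreover have "c n = b n - y * kappa"
      by (simp add: c_def basis_def L0_pderiv2_node_square)
    ultimately show ?thesis by simp
  qed
  thus ?thesis by (rule that)
qed

lemma isCont_det_gram: "isCont (\<lambda>y. Determinant.det (gram e y)) x"
proof -
  have cont: "isCont (\<lambda>y. L e (y * e) P) x" for P
    unfolding L_def mixture_def
    by (intro continuous_intros isCont_o2[OF _ isCont_poly_heat] isCont_o2[OF _ isCont_coeff_heat])
  show ?thesis
    unfolding isCont_def
  proof (rule tendsto_det[OF gram_carrier gram_carrier])
    fix i k assume ik: "i < n + 1" "k < n + 1"
    have "((\<lambda>y. L e (y * e) (basis i * basis k)) \<longlongrightarrow> L e (x * e) (basis i * basis k)) (at x)"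
      using cont unfolding isCont_def .
    from tendsto_mult[OF this tendsto_const[of "1 / (if i = n then e else 1)"]]
    show "((\<lambda>y. gram e y $$ (i, k)) \<longlongrightarrow> gram e x $$ (i, k)) (at x)"
      using ik by (simp add: gram_def)
  qed
qed

text \<open>
  The limit of the determinant is affine in $y$ with nonzero slope, so the determinant changes sign on
  a fixed interval of rates once $e$ is small, and the intermediate value theorem produces a rate at
  which the Gram matrix is singular. Boundedness of the rate \<open>y\<close> makes the shift of the
  variance an $O(e)$.
\<close>

lemma eventually_null_vector:
  obtains C y where "\<And>e. \<bar>y e\<bar> \<le> C"
    and "eventually (\<lambda>e. \<exists>v. (\<exists>k\<le>n. v k \<noteq> 0) \<and>
      (\<forall>i\<le>n. (\<Sum>k\<le>n. L e (y e * e) (basis i * basis k) * v k) = 0)) (at 0)"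
proof -
  obtain b where lim: "\<And>y. ((\<lambda>e. Determinant.det (gram e y)) \<longlongrightarrow> (\<Prod>i<n. w i) * (b - y * kappa)) (at 0)"
    by (rule det_gram_tendsto) blast
  \<comment> \<open>The limit $b - y \kappa$ (up to a positive factor) is at most $-1$ at $y = C$ and at least $1$ at $y = -C$.\<close>
  define C where "C = (\<bar>b\<bar> + 1) / kappa"
  have C: "C \<ge> 0" "C * kappa = \<bar>b\<bar> + 1" using kappa_gt_0 by (simp_all add: C_def)
  have W: "(\<Prod>i<n. w i) > 0" using w_pos by (intro prod_pos) auto
  have "eventually (\<lambda>e. Determinant.det (gram e C) < 0) (at 0)"
    by (rule order_tendstoD(2)[OF lim]) (use C W in \<open>auto simp: mult_less_0_iff\<close>)
  moreover have "eventually (\<lambda>e. Determinant.det (gram e (- C)) > 0) (at 0)"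
    by (rule order_tendstoD(1)[OF lim]) (use C W in \<open>auto simp: zero_less_mult_iff\<close>)
  ultimately have ev: "eventually (\<lambda>e. \<exists>y. \<bar>y\<bar> \<le> C \<and> Determinant.det (gram e y) = 0) (at 0)"
  proof eventually_elim
    case (elim e)
    have "\<exists>y\<ge>- C. y \<le> C \<and> Determinant.det (gram e y) = 0"
      by (rule IVT2) (use elim C isCont_det_gram in auto)
    thus ?case by (auto simp: abs_le_iff)
  qed
  \<comment> \<open>The default value 0 keeps the bound valid for every \<open>e\<close>, which is convenient for limits.\<close>
  define y where "y e = (if \<exists>y. \<bar>y\<bar> \<le> C \<and> Determinant.det (gram e y) = 0
      then SOME y. \<bar>y\<bar> \<le> C \<and> Determinant.det (gram e y) = 0 else 0)" for e
  have y: "\<bar>y e\<bar> \<le> C" for e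
    using someI_ex[of "\<lambda>y. \<bar>y\<bar> \<le> C \<and> Determinant.det (gram e y) = 0"] C(1) by (auto simp: y_def)
  moreover have "eventually (\<lambda>e::real. e \<noteq> 0) (at 0)" by (simp add: eventually_at_filter)
  with ev have "eventually (\<lambda>e. \<exists>v. (\<exists>k\<le>n. v k \<noteq> 0) \<and>
      (\<forall>i\<le>n. (\<Sum>k\<le>n. L e (y e * e) (basis i * basis k) * v k) = 0)) (at 0)"
  proof eventually_elim
    case (elim e)
    have "Determinant.det (gram e (y e)) = 0"
      using someI_ex[OF elim(1)] elim(1) by (auto simp: y_def)
    then obtain v where v: "v \<in> carrier_vec (n + 1)" "v \<noteq> 0\<^sub>v (n + 1)"
      "gram e (y e) *\<^sub>v v = 0\<^sub>v (n + 1)"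
      using det_0_iff_vec_prod_zero_field[OF gram_carrier] by blast
    have "\<exists>k\<le>n. v $ k \<noteq> 0"
    proof (rule ccontr)
      assume "\<not> (\<exists>k\<le>n. v $ k \<noteq> 0)"
      hence "v = 0\<^sub>v (n + 1)" using v(1) by (intro eq_vecI) auto
      with v(2) show False by simp
    qed
    moreover have "(\<Sum>k\<le>n. L e (y e * e) (basis i * basis k) * v $ k) = 0" if i: "i \<le> n" for i
    proof -
      have "0 = (gram e (y e) *\<^sub>v v) $ i" using i by (simp add: v(3))
      also have "\<dots> = (\<Sum>k\<le>n. L e (y e * e) (basis i * basis k) / (if i = n then e else 1) * v $ k)"
        using i v(1)
        by (auto simp: gram_def scalar_prod_def atLeast0LessThan lessThan_Suc_atMost simp del: sum.atMost_Suc intro!: sum.cong)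
      also have "\<dots> = (\<Sum>k\<le>n. L e (y e * e) (basis i * basis k) * v $ k) / (if i = n then e else 1)"
        unfolding sum_divide_distrib by (intro sum.cong) auto
      finally show ?thesis using elim(2) by (auto split: if_splits)
    qed
    ultimately show ?case by (intro exI[of _ "\<lambda>k. v $ k"]) auto
  qed
  ultimately show ?thesis by (rule that)
qed

lemma L_linear_bound:
  assumes y: "\<And>e. \<bar>y e\<bar> \<le> C" and P: "L0 P = 0"
  obtains K where "K \<ge> 0" "eventually (\<lambda>e. \<bar>L e (y e * e) P\<bar> \<le> K * \<bar>e\<bar>) (at 0)"
proof
  define D where "D = L0 (pderiv (pderiv P))"
  define b where "b = Polynomial.coeff (heat (- t0) P) m"
  define K where "K = \<bar>b\<bar> + 1 + C / 2 * \<bar>D\<bar>"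
  have C: "C \<ge> 0" using y[of 0] by linarith
  thus "K \<ge> 0" by (simp add: K_def)
  have "eventually (\<lambda>e. dist (L e (y e * e) P / e + y e / 2 * D) b < 1) (at 0)"
    using tendstoD[OF L_quotient_tendsto[OF y P], of 1] by (simp add: D_def b_def)
  moreover have "eventually (\<lambda>e::real. e \<noteq> 0) (at 0)" by (simp add: eventually_at_filter)
  ultimately show "eventually (\<lambda>e. \<bar>L e (y e * e) P\<bar> \<le> K * \<bar>e\<bar>) (at 0)"
  proof eventually_elim
    case (elim e)
    have "\<bar>y e / 2 * D\<bar> \<le> C / 2 * \<bar>D\<bar>"
      using y[of e] by (auto simp: abs_mult intro!: mult_right_mono)
    hence "\<bar>L e (y e * e) P / e\<bar> \<le> K"
      using elim(1) unfolding K_def dist_real_def by linarith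
    thus ?case using elim(2) by (simp add: abs_divide divide_le_eq)
  qed
qed

lemma L_square_pos:
  assumes \<delta>: "\<delta> > 0"
    and form: "\<And>x. (\<Sum>i<n. \<Sum>k<n. x i * x k * L e s (lagrange n u i * lagrange n u k))
        \<ge> \<delta> * (\<Sum>i<n. (x i)\<^sup>2)"
    and f: "Polynomial.degree f < n" "f \<noteq> 0"
  shows "L e s (f * f) > 0"
proof -
  have interp: "f = (\<Sum>i<n. Polynomial.smult (poly f (u i)) (lagrange n u i))"
    by (rule lagrange_interpolation[OF inj_u f(1)])
  have "f * f = (\<Sum>i<n. \<Sum>k<n. Polynomial.smult (poly f (u i) * poly f (u k))
      (lagrange n u i * lagrange n u k))"
    by (subst (1 2) interp) (simp add: sum_product mult_ac)
  hence "L e s (f * f) = (\<Sum>i<n. \<Sum>k<n. poly f (u i) * poly f (u k) * L e s (lagrange n u i * lagrange n u k))"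
    by (simp only: L_sum L_smult)
  moreover have "(\<Sum>i<n. (poly f (u i))\<^sup>2) > 0"
  proof -
    have "\<exists>i<n. poly f (u i) \<noteq> 0"
    proof (rule ccontr)
      assume "\<not> (\<exists>i<n. poly f (u i) \<noteq> 0)"
      hence "f = 0" using interp by simp
      with f(2) show False by simp
    qed
    thus ?thesis by (auto intro!: sum_pos2)
  qed
  ultimately show ?thesis using form[of "\<lambda>i. poly f (u i)"] \<delta>
    by (smt (verit) mult_pos_pos)
qed

text \<open>
  A null vector cannot lie in the span of the Lagrange polynomials, where the form is positive
  definite, so it can be normalised to be the node polynomial plus a correction. Pairing the
  equations of the first $n$ rows with the correction bounds it by the entries
  $L(\ell_i p)$, which are small.
\<close>

lemma null_vector_bound:
  fixes \<delta> \<eta> :: real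
  assumes \<delta>: "\<delta> > 0"
    and form: "\<And>x. (\<Sum>i<n. \<Sum>k<n. x i * x k * L e s (lagrange n u i * lagrange n u k))
        \<ge> \<delta> * (\<Sum>i<n. (x i)\<^sup>2)"
    and small: "\<And>i. i < n \<Longrightarrow> \<bar>L e s (lagrange n u i * monic_with_roots n u)\<bar> \<le> \<eta>"
    and v: "\<exists>k\<le>n. v k \<noteq> 0"
    and null: "\<And>i. i \<le> n \<Longrightarrow> (\<Sum>k\<le>n. L e s (basis i * basis k) * v k) = 0"
  shows "\<exists>c. (\<forall>k<n. \<bar>c k\<bar> \<le> n * \<eta> / \<delta>) \<and> (\<forall>Q. Polynomial.degree Q \<le> n \<longrightarrow>
    L e s ((monic_with_roots n u + (\<Sum>k<n. Polynomial.smult (c k) (lagrange n u k))) * Q) = 0)"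
proof -
  let ?p = "monic_with_roots n u" and ?l = "lagrange n u"
  have row: "(\<Sum>k<n. L e s (basis i * ?l k) * v k) + L e s (basis i * ?p) * v n = 0" if "i \<le> n" for i
    using null[OF that] by (simp add: lessThan_Suc_atMost[symmetric] basis_def)
  have row_l: "(\<Sum>k<n. L e s (?l i * ?l k) * v k) = - L e s (?l i * ?p) * v n" if "i < n" for i
    using row[of i] that by (simp add: basis_def)
  have vn: "v n \<noteq> 0"
  proof
    assume "v n = 0"
    hence "(\<Sum>i<n. v i * (\<Sum>k<n. L e s (?l i * ?l k) * v k)) = 0"
      using row_l by simp
    hence "(\<Sum>i<n. \<Sum>k<n. v i * v k * L e s (?l i * ?l k)) = 0"
      by (simp add: sum_distrib_left mult_ac)
    hence "\<delta> * (\<Sum>i<n. (v i)\<^sup>2) \<le> 0" using form[of v] by simp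
    hence "(\<Sum>i<n. (v i)\<^sup>2) = 0" using \<delta>
      by (intro antisym sum_nonneg) (auto simp: mult_le_0_iff)
    hence "v i = 0" if "i < n" for i using that by (subst (asm) sum_nonneg_eq_0_iff) auto
    with \<open>v n = 0\<close> v show False by (metis le_neq_implies_less)
  qed
  \<comment> \<open>Normalisation of the coefficient of the node polynomial to 1.\<close>
  define c where "c k = v k / v n" for k
  have row_c: "(\<Sum>k<n. c k * L e s (basis i * ?l k)) = - L e s (basis i * ?p)" if "i \<le> n" for i
  proof -
    have "(\<Sum>k<n. c k * L e s (basis i * ?l k)) = (\<Sum>k<n. L e s (basis i * ?l k) * v k) / v n"
      by (simp add: c_def sum_divide_distrib mult.commute)
    also have "(\<Sum>k<n. L e s (basis i * ?l k) * v k) = - L e s (basis i * ?p) * v n"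
      using row[OF that] by simp
    finally show ?thesis using vn by simp
  qed
  define q where "q = ?p + (\<Sum>k<n. Polynomial.smult (c k) (?l k))"
  have orth_basis: "L e s (q * basis i) = 0" if "i \<le> n" for i
  proof -
    have "q * basis i = basis i * ?p + (\<Sum>k<n. Polynomial.smult (c k) (basis i * ?l k))"
      by (simp add: q_def algebra_simps sum_distrib_left)
    thus ?thesis using row_c[OF that] by (simp only: L_add L_sum L_smult)
  qed
  have orth: "L e s (q * Q) = 0" if Q: "Polynomial.degree Q \<le> n" for Q
  proof -
    define R where "R = Q - Polynomial.smult (Polynomial.coeff Q n) ?p"
    have "Polynomial.coeff R n = 0" by (simp add: R_def)
    moreover have "Polynomial.degree R \<le> n"
      unfolding R_def using Q by (intro degree_diff_le order.trans[OF degree_smult_le]) auto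
    ultimately have R_deg: "Polynomial.degree R < n"
      using n_pos by (metis le_neq_implies_less leading_coeff_0_iff degree_0)
    have "Q = Polynomial.smult (Polynomial.coeff Q n) (basis n) +
        (\<Sum>k<n. Polynomial.smult (poly R (u k)) (basis k))"
      using lagrange_interpolation[OF inj_u R_deg] by (simp add: basis_def R_def algebra_simps)
    hence "q * Q = Polynomial.smult (Polynomial.coeff Q n) (q * basis n) +
        (\<Sum>k<n. Polynomial.smult (poly R (u k)) (q * basis k))"
      by (metis (no_types, lifting) distrib_left mult_smult_right sum.cong sum_distrib_left)
    thus ?thesis by (simp add: L_add L_sum L_smult orth_basis)
  qed
  have bound: "\<bar>c k\<bar> \<le> n * \<eta> / \<delta>" if k: "k < n" for k
  proof -
    define S where "S = (\<Sum>i<n. \<bar>c i\<bar>)"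
    have ck: "\<bar>c k\<bar> \<le> S" unfolding S_def using k by (intro member_le_sum) auto
    have eta: "\<eta> \<ge> 0" using small[OF k] by linarith
    have "\<delta> * (\<Sum>i<n. (c i)\<^sup>2) \<le> (\<Sum>i<n. \<Sum>k<n. c i * c k * L e s (?l i * ?l k))"
      by (rule form)
    also have "\<dots> = (\<Sum>i<n. c i * (\<Sum>k<n. c k * L e s (?l i * ?l k)))"
      by (simp add: sum_distrib_left mult.assoc)
    also have "\<dots> = (\<Sum>i<n. c i * - L e s (?l i * ?p))"
    proof (intro sum.cong refl)
      fix i assume "i \<in> {..<n}"
      thus "c i * (\<Sum>k<n. c k * L e s (?l i * ?l k)) = c i * - L e s (?l i * ?p)"
        using row_c[of i] by (simp add: basis_def)
    qed
    also have "\<dots> \<le> (\<Sum>i<n. \<bar>c i\<bar> * \<eta>)"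
    proof (rule sum_mono)
      fix i assume "i \<in> {..<n}"
      have "c i * - L e s (?l i * ?p) \<le> \<bar>c i\<bar> * \<bar>L e s (?l i * ?p)\<bar>"
        using abs_ge_self[of "c i * - L e s (?l i * ?p)"] by (simp only: abs_mult abs_minus_cancel)
      also have "\<dots> \<le> \<bar>c i\<bar> * \<eta>" using small[of i] \<open>i \<in> {..<n}\<close> by (intro mult_left_mono) auto
      finally show "c i * - L e s (?l i * ?p) \<le> \<bar>c i\<bar> * \<eta>" .
    qed
    also have "\<dots> = S * \<eta>" by (simp add: S_def sum_distrib_right)
    finally have le: "\<delta> * (\<Sum>i<n. (c i)\<^sup>2) \<le> S * \<eta>" .
    have "S\<^sup>2 \<le> n * (\<Sum>i<n. (c i)\<^sup>2)"
      using sum_squared_le_sum_of_squares[of "\<lambda>i. \<bar>c i\<bar>" "{..<n}"] by (simp add: S_def mult.commute)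
    hence "\<delta> * S\<^sup>2 \<le> n * (\<delta> * (\<Sum>i<n. (c i)\<^sup>2))" using \<delta> by simp
    also have "\<dots> \<le> n * (S * \<eta>)" using le by (intro mult_left_mono) auto
    finally have "S * (\<delta> * S) \<le> S * (n * \<eta>)" by (simp add: power2_eq_square algebra_simps)
    moreover have "S \<ge> 0" unfolding S_def by (intro sum_nonneg) auto
    ultimately have "\<delta> * S \<le> n * \<eta>" using eta \<delta>
      by (cases "S = 0") (auto simp: mult_le_cancel_left_pos)
    hence "S \<le> n * \<eta> / \<delta>" using \<delta> by (simp add: field_simps)
    thus ?thesis using ck by linarith
  qed
  show ?thesis using bound orth unfolding q_def by blast
qed

text \<open>
  The weight of a node is the value of \<open>L\<close> on the Lagrange polynomial of that node and, by
  the quadrature formula, also on its square, hence positive.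
\<close>

lemma gauss_quadrature_perturbed:
  assumes \<delta>: "\<delta> > 0"
    and form: "\<And>x. (\<Sum>i<n. \<Sum>k<n. x i * x k * L e s (lagrange n u i * lagrange n u k))
        \<ge> \<delta> * (\<Sum>i<n. (x i)\<^sup>2)"
    and inj: "inj_on r {..<n}"
    and orth: "\<And>Q. Polynomial.degree Q \<le> n \<Longrightarrow> L e s (monic_with_roots n r * Q) = 0"
  shows "\<exists>\<omega>. (\<forall>i<n. \<omega> i > 0) \<and>
    (\<forall>P. Polynomial.degree P \<le> 2 * n \<longrightarrow> L e s P = (\<Sum>i<n. \<omega> i * poly P (r i)))"
proof -
  define \<omega> where "\<omega> i = L e s (lagrange n r i)" for i
  have quad: "L e s P = (\<Sum>i<n. \<omega> i * poly P (r i))" if "Polynomial.degree P \<le> 2 * n" for P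
    unfolding \<omega>_def using linear_functional_L inj n_pos orth that by (rule gauss_quadrature)
  have "\<omega> i > 0" if i: "i < n" for i
  proof -
    let ?f = "lagrange n r i"
    have val: "poly ?f (r k) = (if i = k then 1 else 0)" if "k < n" for k
      using poly_lagrange[OF inj i that] .
    have "?f \<noteq> 0" using val[OF i] by auto
    with \<delta> form degree_lagrange[OF i] have "L e s (?f * ?f) > 0" by (rule L_square_pos)
    moreover have "Polynomial.degree (?f * ?f) \<le> 2 * n"
      using degree_mult_le[of ?f ?f] degree_lagrange[OF i, of r] by linarith
    ultimately have "(\<Sum>k<n. \<omega> k * poly (?f * ?f) (r k)) > 0" by (simp only: quad)
    also have "(\<Sum>k<n. \<omega> k * poly (?f * ?f) (r k)) = (\<Sum>k<n. if i = k then \<omega> i else 0)"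
      using val by (intro sum.cong) auto
    finally show ?thesis using i by simp
  qed
  with quad show ?thesis by blast
qed

lemma eventually_L_positive_definite:
  assumes s: "(s \<longlongrightarrow> 0) (at 0)"
  obtains \<delta> where "\<delta> > 0"
    "eventually (\<lambda>e. \<forall>x. (\<Sum>i<n. \<Sum>k<n. x i * x k * L e (s e) (lagrange n u i * lagrange n u k))
        \<ge> \<delta> * (\<Sum>i<n. (x i)\<^sup>2)) (at 0)"
proof -
  define wmin where "wmin = Min (w ` {..<n})"
  have wmin: "wmin > 0" "\<And>i. i < n \<Longrightarrow> w i \<ge> wmin"
  proof -
    have "w ` {..<n} \<noteq> {}" using n_pos by auto
    thus "wmin > 0" using w_pos by (auto simp: wmin_def Min_gr_iff)
  qed (auto simp: wmin_def)
  \<comment> \<open>Deviations of this size use up half of the smallest weight.\<close>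
  define \<eta> where "\<eta> = wmin / (2 * n)"
  have \<eta>: "\<eta> > 0" "2 * real n * \<eta> = wmin" using wmin n_pos by (auto simp: \<eta>_def)
  have L0: "L0 (lagrange n u i * lagrange n u k) = (if i = k then w i else 0)"
    if "i < n" "k < n" for i k
    using that by (simp add: L0_lagrange_mult poly_lagrange[OF inj_u])
  have "eventually (\<lambda>e. \<forall>i\<in>{..<n}. \<forall>k\<in>{..<n}.
      dist (L e (s e) (lagrange n u i * lagrange n u k)) (if i = k then w i else 0) < \<eta>) (at 0)"
  proof (intro eventually_ball_finite ballI)
    fix i k assume "i \<in> {..<n}" "k \<in> {..<n}"
    hence "L0 (lagrange n u i * lagrange n u k) = (if i = k then w i else 0)" using L0 by simp
    thus "eventually (\<lambda>e. dist (L e (s e) (lagrange n u i * lagrange n u k)) (if i = k then w i else 0) < \<eta>) (at 0)"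
      using tendstoD[OF L_tendsto[OF tendsto_ident_at s] \<eta>(1), of "lagrange n u i * lagrange n u k"]
      by (simp only:)
  qed auto
  hence "eventually (\<lambda>e. \<forall>x. (\<Sum>i<n. \<Sum>k<n. x i * x k * L e (s e) (lagrange n u i * lagrange n u k))
        \<ge> n * \<eta> * (\<Sum>i<n. (x i)\<^sup>2)) (at 0)"
  proof eventually_elim
    case (elim e)
    show ?case
    proof
      fix x :: "nat \<Rightarrow> real"
      show "(\<Sum>i<n. \<Sum>k<n. x i * x k * L e (s e) (lagrange n u i * lagrange n u k))
        \<ge> n * \<eta> * (\<Sum>i<n. (x i)\<^sup>2)"
      proof (rule quadratic_form_diagonally_dominant[where w = w])
        fix i k assume "i < n" "k < n"
        with elim have "dist (L e (s e) (lagrange n u i * lagrange n u k)) (if i = k then w i else 0) < \<eta>"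
          by (meson lessThan_iff)
        thus "\<bar>L e (s e) (lagrange n u i * lagrange n u k) - (if i = k then w i else 0)\<bar> \<le> \<eta>"
          unfolding dist_real_def by (rule less_imp_le)
      next
        fix i assume "i < n"
        thus "w i \<ge> 2 * real n * \<eta>" unfolding \<eta>(2) by (rule wmin(2))
      qed
    qed
  qed
  thus ?thesis using that[of "n * \<eta>"] \<eta>(1) n_pos by simp
qed

text \<open>
  The existence part of the inverse function theorem for the moment map, in the direction of one
  moment. New nodes and weights exist; the variance shift and the node polynomial differ from the
  original ones by $O(e)$.
\<close>

lemma eventually_perturbed_state:
  obtains y :: "real \<Rightarrow> real" and d :: "real \<Rightarrow> nat \<Rightarrow> real" and C K :: real
    where "\<And>e. \<bar>y e\<bar> \<le> C"
    and "eventually (\<lambda>e. \<forall>k<n. \<bar>d e k\<bar> \<le> K * \<bar>e\<bar>) (at 0)"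
    and "eventually (\<lambda>e. \<exists>\<omega> r. inj_on r {..<n} \<and> (\<forall>i<n. \<omega> i > 0) \<and>
      monic_with_roots n u + (\<Sum>k<n. Polynomial.smult (d e k) (lagrange n u k)) = monic_with_roots n r \<and>
      (\<forall>P. Polynomial.degree P \<le> 2 * n \<longrightarrow> L e (y e * e) P = (\<Sum>i<n. \<omega> i * poly P (r i)))) (at 0)"
proof -
  let ?p = "monic_with_roots n u" and ?l = "lagrange n u"
  obtain C y where y: "\<And>e. \<bar>y e\<bar> \<le> C"
    and null: "eventually (\<lambda>e. \<exists>v. (\<exists>k\<le>n. v k \<noteq> 0) \<and>
      (\<forall>i\<le>n. (\<Sum>k\<le>n. L e (y e * e) (basis i * basis k) * v k) = 0)) (at 0)"
    by (rule eventually_null_vector) blast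
  have s: "((\<lambda>e. y e * e) \<longlongrightarrow> 0) (at 0)"
    by (rule tendsto_bounded_times_null[OF y tendsto_ident_at])
  obtain \<delta> where \<delta>: "\<delta> > 0" and form:
    "eventually (\<lambda>e. \<forall>x. (\<Sum>i<n. \<Sum>k<n. x i * x k * L e (y e * e) (?l i * ?l k))
        \<ge> \<delta> * (\<Sum>i<n. (x i)\<^sup>2)) (at 0)"
    by (rule eventually_L_positive_definite[OF s])
  have "\<forall>i. \<exists>K. K \<ge> 0 \<and> eventually (\<lambda>e. \<bar>L e (y e * e) (?l i * ?p)\<bar> \<le> K * \<bar>e\<bar>) (at 0)"
  proof
    fix i
    have "L0 (?l i * ?p) = 0" using L0_node_mult[of "?l i"] by (simp add: mult.commute)
    from L_linear_bound[OF y this] obtain K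
      where "K \<ge> 0" "eventually (\<lambda>e. \<bar>L e (y e * e) (?l i * ?p)\<bar> \<le> K * \<bar>e\<bar>) (at 0)" .
    thus "\<exists>K. K \<ge> 0 \<and> eventually (\<lambda>e. \<bar>L e (y e * e) (?l i * ?p)\<bar> \<le> K * \<bar>e\<bar>) (at 0)" by blast
  qed
  from choice[OF this] obtain K0 where K0: "\<And>i. K0 i \<ge> 0"
    "\<And>i. eventually (\<lambda>e. \<bar>L e (y e * e) (?l i * ?p)\<bar> \<le> K0 i * \<bar>e\<bar>) (at 0)" by blast
  define K1 where "K1 = (\<Sum>i<n. K0 i)"
  have "eventually (\<lambda>e. \<forall>i\<in>{..<n}. \<bar>L e (y e * e) (?l i * ?p)\<bar> \<le> K0 i * \<bar>e\<bar>) (at 0)"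
    by (rule eventually_ball_finite) (use K0 in auto)
  hence small: "eventually (\<lambda>e. \<forall>i\<in>{..<n}. \<bar>L e (y e * e) (?l i * ?p)\<bar> \<le> K1 * \<bar>e\<bar>) (at 0)"
  proof eventually_elim
    case (elim e)
    have "K0 i \<le> K1" if "i < n" for i
      unfolding K1_def using that K0(1) by (intro member_le_sum) auto
    hence "K0 i * \<bar>e\<bar> \<le> K1 * \<bar>e\<bar>" if "i < n" for i
      using that by (intro mult_right_mono) auto
    thus ?case using elim by (meson lessThan_iff order.trans)
  qed
  define K where "K = n * K1 / \<delta>"
  define good where "good e c \<longleftrightarrow> (\<forall>k<n. \<bar>c k\<bar> \<le> K * \<bar>e\<bar>) \<and> (\<forall>Q. Polynomial.degree Q \<le> n \<longrightarrow>
    L e (y e * e) ((?p + (\<Sum>k<n. Polynomial.smult (c k) (?l k))) * Q) = 0)" for e c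
  have "eventually (\<lambda>e. \<exists>c. good e c) (at 0)"
    using null form small
  proof eventually_elim
    case (elim e)
    then obtain v where v: "\<exists>k\<le>n. v k \<noteq> 0"
      "\<And>i. i \<le> n \<Longrightarrow> (\<Sum>k\<le>n. L e (y e * e) (basis i * basis k) * v k) = 0" by blast
    have "\<exists>c. (\<forall>k<n. \<bar>c k\<bar> \<le> n * (K1 * \<bar>e\<bar>) / \<delta>) \<and> (\<forall>Q. Polynomial.degree Q \<le> n \<longrightarrow>
      L e (y e * e) ((?p + (\<Sum>k<n. Polynomial.smult (c k) (?l k))) * Q) = 0)"
    proof (rule null_vector_bound[OF \<delta>])
      show "(\<Sum>i<n. \<Sum>k<n. x i * x k * L e (y e * e) (?l i * ?l k)) \<ge> \<delta> * (\<Sum>i<n. (x i)\<^sup>2)" for x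
        using elim(2) by blast
      show "\<bar>L e (y e * e) (?l i * ?p)\<bar> \<le> K1 * \<bar>e\<bar>" if "i < n" for i
        using elim(3) that by simp
    qed (use v in auto)
    thus ?case by (simp only: good_def K_def mult.assoc times_divide_eq_left)
  qed
  then obtain d where d: "eventually (\<lambda>e. good e (d e)) (at 0)"
    unfolding eventually_ex by blast
  have bound: "eventually (\<lambda>e. \<forall>k<n. \<bar>d e k\<bar> \<le> K * \<bar>e\<bar>) (at 0)"
    using d by eventually_elim (simp add: good_def)
  have "((\<lambda>e. d e k) \<longlongrightarrow> 0) (at 0)" if "k < n" for k
  proof (rule Lim_null_comparison)
    show "eventually (\<lambda>e. norm (d e k) \<le> K * \<bar>e\<bar>) (at 0)"
      using bound by eventually_elim (use that in auto)
    show "((\<lambda>e::real. K * \<bar>e\<bar>) \<longlongrightarrow> 0) (at 0)" by (auto intro!: tendsto_eq_intros)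
  qed
  from eventually_perturbed_real_roots[OF inj_u this]
  have roots: "eventually (\<lambda>e. \<exists>r. inj_on r {..<n} \<and>
    ?p + (\<Sum>k<n. Polynomial.smult (d e k) (?l k)) = monic_with_roots n r) (at 0)" .
  have "eventually (\<lambda>e. \<exists>\<omega> r. inj_on r {..<n} \<and> (\<forall>i<n. \<omega> i > 0) \<and>
      ?p + (\<Sum>k<n. Polynomial.smult (d e k) (?l k)) = monic_with_roots n r \<and>
      (\<forall>P. Polynomial.degree P \<le> 2 * n \<longrightarrow> L e (y e * e) P = (\<Sum>i<n. \<omega> i * poly P (r i)))) (at 0)"
    using roots d form
  proof eventually_elim
    case (elim e)
    then obtain r where r: "inj_on r {..<n}"
      "?p + (\<Sum>k<n. Polynomial.smult (d e k) (?l k)) = monic_with_roots n r" by blast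
    have "L e (y e * e) (monic_with_roots n r * Q) = 0" if "Polynomial.degree Q \<le> n" for Q
      using elim(2) that unfolding good_def r(2) by blast
    from gauss_quadrature_perturbed[OF \<delta> _ r(1) this] elim(3) r show ?case by blast
  qed
  with y bound show ?thesis by (rule that)
qed

end

section \<open>The derivative of the closure\<close>

lemma weighted_mean_ex:
  fixes n :: nat and b u :: "nat \<Rightarrow> real"
  assumes "n > 0" "\<And>i. i < n \<Longrightarrow> b i > 0"
  obtains \<alpha> where "(\<Sum>i<n. b i * (u i - \<alpha>)) = 0"
proof
  define \<alpha> where "\<alpha> = (\<Sum>i<n. b i * u i) / (\<Sum>i<n. b i)"
  have "(\<Sum>i<n. b i) > 0" using assms by (intro sum_pos) auto
  hence "(\<Sum>i<n. b i * u i) = (\<Sum>i<n. b i) * \<alpha>" by (simp add: \<alpha>_def)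
  thus "(\<Sum>i<n. b i * (u i - \<alpha>)) = 0"
    by (simp add: right_diff_distrib sum_subtractf sum_distrib_right)
qed

text \<open>
  The characteristic polynomial of the coefficient matrix after the forward flow: a double root at each
  node, which makes the first variation with respect to weights and nodes vanish, and one more root
  $\alpha$ that is left to be chosen.
\<close>

definition node_square_poly :: "nat \<Rightarrow> (nat \<Rightarrow> real) \<Rightarrow> real \<Rightarrow> real poly" where
  "node_square_poly n u \<alpha> = [:- \<alpha>, 1:] * (monic_with_roots n u * monic_with_roots n u)"

context perturbed_mixture
begin

lemma node_square_poly_degree: "Polynomial.degree (node_square_poly n u \<alpha>) = 2 * n + 1"
  and node_square_poly_lead_coeff: "lead_coeff (node_square_poly n u \<alpha>) = 1"
proof -
  have p: "monic_with_roots n u \<noteq> 0" by (metis monic_with_roots_coeff coeff_0 zero_neq_one)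
  have "Polynomial.degree (monic_with_roots n u * monic_with_roots n u) = 2 * n"
    using p by (subst degree_mult_eq) auto
  thus "Polynomial.degree (node_square_poly n u \<alpha>) = 2 * n + 1"
    using p unfolding node_square_poly_def by (subst degree_mult_eq) auto
  show "lead_coeff (node_square_poly n u \<alpha>) = 1"
    unfolding node_square_poly_def lead_coeff_mult by simp
qed

lemma L0_node_square_poly: "L0 (node_square_poly n u \<alpha>) = 0"
  by (simp add: mixture_zero_time node_square_poly_def del: mult_pCons_left)

text \<open>
  The variation with respect to the variance vanishes if $\alpha$ is the mean of the nodes with
  weights $w_i p'(u_i)^2$.
\<close>

lemma L0_pderiv2_node_square_poly:
  "L0 (pderiv (pderiv (node_square_poly n u \<alpha>))) =
    2 * (\<Sum>i<n. w i * (poly (pderiv (monic_with_roots n u)) (u i))\<^sup>2 * (u i - \<alpha>))"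
proof -
  have "pderiv [:- \<alpha>, 1:] = 1" by (simp add: pderiv_pCons)
  thus ?thesis
    unfolding mixture_zero_time node_square_poly_def sum_distrib_left
    by (intro sum.cong)
       (simp_all add: pderiv_mult pderiv_add power2_eq_square algebra_simps del: pderiv_prod mult_pCons_left)
qed

text \<open>
  The function below is the error of the linear approximation of the closure, divided by $e$, as computed
  in \<open>quadrature_next_moment\<close>. The first part tends to zero by the choice of $\alpha$, the second
  because it is quadratic in the change of the node polynomial, which is of order $e$.
\<close>

lemma next_moment_tendsto:
  fixes \<alpha> :: real
  assumes y: "\<And>e. \<bar>y e\<bar> \<le> C"
    and d: "eventually (\<lambda>e. \<forall>k<n. \<bar>d e k\<bar> \<le> K * \<bar>e\<bar>) (at 0)"
    and \<alpha>: "L0 (pderiv (pderiv (node_square_poly n u \<alpha>))) = 0"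
  shows "((\<lambda>e. (Polynomial.coeff (heat (- t0) (node_square_poly n u \<alpha>)) m - L e (y e * e) (node_square_poly n u \<alpha>) / e) +
      (\<Sum>i<n. \<Sum>k<n. d e i * (d e k / e) * L e (y e * e) ([:- \<alpha>, 1:] * (lagrange n u i * lagrange n u k))))
    \<longlongrightarrow> 0) (at 0)"
proof -
  have s: "((\<lambda>e. y e * e) \<longlongrightarrow> 0) (at 0)"
    by (rule tendsto_bounded_times_null[OF y tendsto_ident_at])
  have first: "((\<lambda>e. Polynomial.coeff (heat (- t0) (node_square_poly n u \<alpha>)) m - L e (y e * e) (node_square_poly n u \<alpha>) / e)
      \<longlongrightarrow> 0) (at 0)"
  proof -
    have "((\<lambda>e. L e (y e * e) (node_square_poly n u \<alpha>) / e + y e / 2 * L0 (pderiv (pderiv (node_square_poly n u \<alpha>))))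
        \<longlongrightarrow> Polynomial.coeff (heat (- t0) (node_square_poly n u \<alpha>)) m) (at 0)"
      by (rule L_quotient_tendsto[OF y L0_node_square_poly])
    from tendsto_diff[OF tendsto_const[of "Polynomial.coeff (heat (- t0) (node_square_poly n u \<alpha>)) m"] this]
    show ?thesis unfolding \<alpha> by simp
  qed
  have second: "((\<lambda>e. \<Sum>i<n. \<Sum>k<n. d e i * (d e k / e) *
      L e (y e * e) ([:- \<alpha>, 1:] * (lagrange n u i * lagrange n u k))) \<longlongrightarrow> 0) (at 0)"
  proof (intro tendsto_null_sum)
    fix i k assume ik: "i \<in> {..<n}" "k \<in> {..<n}"
    have "((\<lambda>e. d e i * (d e k / e)) \<longlongrightarrow> 0) (at 0)"
    proof (rule Lim_null_comparison)
      have "eventually (\<lambda>e::real. e \<noteq> 0) (at 0)" by (simp add: eventually_at_filter)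
      with d show "eventually (\<lambda>e. norm (d e i * (d e k / e)) \<le> (K * \<bar>e\<bar>) * K) (at 0)"
      proof eventually_elim
        case (elim e)
        have "\<bar>d e i\<bar> * \<bar>d e k / e\<bar> \<le> (K * \<bar>e\<bar>) * K"
        proof (rule mult_mono)
          show "\<bar>d e i\<bar> \<le> K * \<bar>e\<bar>" using elim(1) ik by simp
          show "\<bar>d e k / e\<bar> \<le> K" using elim ik by (simp add: abs_divide divide_le_eq)
          show "K * \<bar>e\<bar> \<ge> 0" using \<open>\<bar>d e i\<bar> \<le> K * \<bar>e\<bar>\<close> by linarith
        qed simp
        thus ?case by (simp add: abs_mult)
      qed
      show "((\<lambda>e. (K * \<bar>e\<bar>) * K) \<longlongrightarrow> 0) (at 0)" by (auto intro!: tendsto_eq_intros)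
    qed
    from tendsto_mult[OF this L_tendsto[OF tendsto_ident_at s]]
    show "((\<lambda>e. d e i * (d e k / e) * L e (y e * e) ([:- \<alpha>, 1:] * (lagrange n u i * lagrange n u k)))
      \<longlongrightarrow> 0) (at 0)" by simp
  qed
  show ?thesis using tendsto_add[OF first second] by simp
qed

text \<open>
  Let $q = (x - \alpha) p^2$ and let $c_0$ be $q$ after the backward flow. On $x^{2n+1} - c_0$, of degree at
  most $2n$, the perturbed mixture is known. On $c_0$ it gives the sum over the new atoms of $q$
  evolved for time $s$. The difference of this polynomial and $q$ has degree at most $2n$ again, and at the
  new nodes $p$ agrees with minus its change $g$, so that $q$ may be replaced by $(x - \alpha) g^2$, of
  degree at most $2n-1$. In this way everything is expressed by \<open>L\<close>, and the new nodes and weights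
  drop out.
\<close>

lemma quadrature_next_moment:
  fixes \<alpha> :: real and c :: "nat \<Rightarrow> real"
  assumes p: "monic_with_roots n u + (\<Sum>k<n. Polynomial.smult (c k) (lagrange n u k)) = monic_with_roots n r"
    and quad: "\<And>P. Polynomial.degree P \<le> 2 * n \<Longrightarrow> L e s P = (\<Sum>i<n. \<omega> i * poly P (r i))"
    and m: "m \<le> 2 * n"
  shows "mixture n \<omega> r (t0 + s) (Polynomial.monom 1 (2 * n + 1)) =
    mixture n w u t0 (Polynomial.monom 1 (2 * n + 1))
    - e * Polynomial.coeff (heat (- t0) (node_square_poly n u \<alpha>)) m
    + (e * Polynomial.coeff (heat (- t0) (node_square_poly n u \<alpha>)) m - L e s (node_square_poly n u \<alpha>))
    + (\<Sum>i<n. \<Sum>k<n. c i * c k * L e s ([:- \<alpha>, 1:] * (lagrange n u i * lagrange n u k)))"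
proof -
  let ?q = "node_square_poly n u \<alpha>"
  let ?M = "mixture n \<omega> r"
  let ?x = "Polynomial.monom (1::real) (2 * n + 1)"
  define c0 where "c0 = heat (- t0) ?q"
  define R where "R = c0 - ?x"
  have c0: "Polynomial.degree c0 = 2 * n + 1" "Polynomial.coeff c0 (2 * n + 1) = 1"
    using node_square_poly_degree[of \<alpha>] node_square_poly_lead_coeff[of \<alpha>] lead_coeff_heat[of "- t0" ?q]
    by (simp_all add: c0_def)
  have R_deg: "Polynomial.degree R \<le> 2 * n"
  proof (rule degree_le, intro allI impI)
    fix i assume "2 * n < i"
    hence "i = 2 * n + 1 \<or> i > 2 * n + 1" by linarith
    thus "Polynomial.coeff R i = 0" using c0 by (auto simp: R_def coeff_eq_0)
  qed
  have R_coeff: "Polynomial.coeff R m = Polynomial.coeff c0 m" using m by (simp add: R_def)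
  have quad0: "?M t P = L e s (heat t P)" if "Polynomial.degree P \<le> 2 * n" for t P
    using quad[of "heat t P"] that by (simp add: mixture_def)
  have L_heat: "L e s (heat (t0 + s) P) = mixture n w u t0 P + e * Polynomial.coeff P m"
    "L e s (heat s P) = L0 P + e * Polynomial.coeff (heat (- t0) P) m" for P
    by (simp_all add: L_def mixture_heat heat_heat)
  have diff_new: "?M t (P - Q) = ?M t P - ?M t Q" for t P Q
    by (rule linear_functional_diff[OF linear_functional_mixture])
  have x: "?x = c0 - R" by (simp add: R_def)

  have "?M (t0 + s) ?x = ?M (t0 + s) c0 - ?M (t0 + s) R"
    unfolding x by (rule diff_new)
  also have "?M (t0 + s) c0 = ?M 0 (heat s ?q)"
    by (simp add: c0_def mixture_heat)
  also have "?M 0 (heat s ?q) = ?M 0 (heat s ?q - ?q) + ?M 0 ?q"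
    by (simp add: diff_new)
  also have "?M (t0 + s) R = mixture n w u t0 R + e * Polynomial.coeff c0 m"
    using quad0[OF R_deg] by (simp add: L_heat R_coeff)
  also have "mixture n w u t0 R = mixture n w u t0 c0 - mixture n w u t0 ?x"
    unfolding R_def by (rule linear_functional_diff[OF linear_functional_mixture])
  also have "mixture n w u t0 c0 = 0"
    by (simp add: c0_def mixture_heat L0_node_square_poly)
  also have "?M 0 (heat s ?q - ?q) = e * Polynomial.coeff c0 m - L e s ?q"
  proof -
    have "Polynomial.degree (heat s ?q - ?q) \<le> 2 * n"
    proof (rule degree_le, intro allI impI)
      fix i assume "2 * n < i"
      hence "i = 2 * n + 1 \<or> i > 2 * n + 1" by linarith
      thus "Polynomial.coeff (heat s ?q - ?q) i = 0"
        using lead_coeff_heat[of s ?q] node_square_poly_degree[of \<alpha>] by (auto simp: coeff_eq_0)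
    qed
    from quad0[OF this, of 0] show ?thesis by (simp add: L_diff L_heat L0_node_square_poly c0_def)
  qed
  also have "?M 0 ?q = (\<Sum>i<n. \<Sum>k<n. c i * c k * L e s ([:- \<alpha>, 1:] * (lagrange n u i * lagrange n u k)))"
  proof -
    define g where "g = (\<Sum>k<n. Polynomial.smult (c k) (lagrange n u k))"
    have g_deg: "Polynomial.degree g \<le> n - 1"
      unfolding g_def
    proof (rule degree_sum_le)
      fix k assume "k \<in> {..<n}"
      hence "Polynomial.degree (lagrange n u k) \<le> n - 1" using degree_lagrange[of k n u] by simp
      thus "Polynomial.degree (Polynomial.smult (c k) (lagrange n u k)) \<le> n - 1"
        by (rule order.trans[OF degree_smult_le])
    qed simp
    have "Polynomial.degree ([:- \<alpha>, 1:] * (g * g)) \<le> 1 + ((n - 1) + (n - 1))"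
      by (intro order.trans[OF degree_mult_le] add_mono g_deg) simp
    hence deg: "Polynomial.degree ([:- \<alpha>, 1:] * (g * g)) \<le> 2 * n" using n_pos by linarith
    have root: "poly (monic_with_roots n u) (r i) = - poly g (r i)" if "i < n" for i
    proof -
      have "poly (monic_with_roots n u + g) (r i) = 0" unfolding g_def p using that by simp
      thus ?thesis by simp
    qed
    have "?M 0 ?q = ?M 0 ([:- \<alpha>, 1:] * (g * g))"
      unfolding mixture_zero_time node_square_poly_def
      by (intro sum.cong) (simp_all add: root del: mult_pCons_left)
    also have "\<dots> = L e s ([:- \<alpha>, 1:] * (g * g))" using quad0[OF deg, of 0] by simp
    also have "[:- \<alpha>, 1:] * (g * g) = (\<Sum>i<n. \<Sum>k<n. Polynomial.smult (c i * c k)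
        ([:- \<alpha>, 1:] * (lagrange n u i * lagrange n u k)))"
      by (simp add: g_def sum_product sum_distrib_left mult_ac del: mult_pCons_left mult_pCons_right)
    finally show ?thesis by (simp only: L_sum L_smult)
  qed
  finally show ?thesis by (simp add: c0_def)
qed

end

lemma mixture_cong:
  assumes "\<And>i. i < n \<Longrightarrow> w i = w' i" "\<And>i. i < n \<Longrightarrow> u i = u' i"
  shows "mixture n w u t P = mixture n w' u' t P"
  using assms by (simp add: mixture_def)

lemma Omega_open_witness:
  assumes "\<And>i. i < N \<Longrightarrow> \<omega> i > 0" "inj_on r {..<N}" "t > 0"
  shows "\<exists>V\<in>Omega_open N. \<forall>k. moment N V k = mixture N \<omega> r t (Polynomial.monom 1 k)"
proof -
  define V where "V = Matrix.vec (2 * N + 1)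
    (\<lambda>i. if i = 2 * N then t else if even i then \<omega> (i div 2) else r (i div 2))"
  have V: "weight V i = \<omega> i" "node V i = r i" if "i < N" for i
    using that by (simp_all add: V_def weight_def node_def)
  have t: "sigma2 N V = t" by (simp add: V_def sigma2_def)
  have "V \<in> Omega_open N"
    using assms V t by (auto simp: Omega_open_def V_def[symmetric] inj_on_eq_iff) (simp add: V_def)
  moreover have "moment N V k = mixture N \<omega> r t (Polynomial.monom 1 k)" for k
    using assms(3) t by (subst moment_eq_mixture) (auto intro!: mixture_cong V)
  ultimately show ?thesis by blast
qed

text \<open>
  For small $e$ the changed moment vector is again the moment vector of a state in
  \<open>Omega_open\<close>, so that the closure can be evaluated there and the difference quotient is explicit.
\<close>

lemma partial_deriv_Mbar:
  assumes N: "N > 0" and W: "W \<in> Omega_open N" and m: "m \<le> 2 * N"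
    and \<alpha>: "(\<Sum>i<N. weight W i * (poly (pderiv (monic_with_roots N (node W))) (node W i))\<^sup>2 *
      (node W i - \<alpha>)) = 0"
  shows "partial_deriv (Mbar N) m (moment_map N W) =
    - Polynomial.coeff (heat (- sigma2 N W) (node_square_poly N (node W) \<alpha>)) m"
proof -
  define M where "M = moment_map N W"
  define t0 where "t0 = sigma2 N W"
  define w u where "w = weight W" and "u = node W"
  have t0: "t0 > 0" using W by (simp add: t0_def Omega_open_def)
  interpret perturbed_mixture N w u t0 m
    using N W by unfold_locales (auto simp: Omega_open_def w_def u_def inj_on_def)
  have M: "dim_vec M = 2 * N + 1" "\<And>k. k \<le> 2 * N \<Longrightarrow> M $ k = mixture N w u t0 (Polynomial.monom 1 k)"
    using t0 by (simp_all add: M_def moment_map_def moment_eq_mixture t0_def w_def u_def)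
  define q where "q = node_square_poly N u \<alpha>"
  define c where "c = Polynomial.coeff (heat (- t0) q) m"
  obtain y C d K where y: "\<And>e. \<bar>y e\<bar> \<le> C"
    and d: "eventually (\<lambda>e. \<forall>k<N. \<bar>d e k\<bar> \<le> K * \<bar>e\<bar>) (at 0)"
    and state: "eventually (\<lambda>e. \<exists>\<omega> r. inj_on r {..<N} \<and> (\<forall>i<N. \<omega> i > 0) \<and>
      monic_with_roots N u + (\<Sum>k<N. Polynomial.smult (d e k) (lagrange N u k)) = monic_with_roots N r \<and>
      (\<forall>P. Polynomial.degree P \<le> 2 * N \<longrightarrow> L e (y e * e) P = (\<Sum>i<N. \<omega> i * poly P (r i)))) (at 0)"
    by (rule eventually_perturbed_state) blast
  have s: "((\<lambda>e. y e * e) \<longlongrightarrow> 0) (at 0)"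
    by (rule tendsto_bounded_times_null[OF y tendsto_ident_at])
  have pos: "eventually (\<lambda>e. t0 + y e * e > 0) (at 0)"
    using order_tendstoD(1)[OF s, of "- t0"] t0 by (auto elim: eventually_mono)
  define rem where "rem e = (c - L e (y e * e) q / e) +
      (\<Sum>i<N. \<Sum>k<N. d e i * (d e k / e) * L e (y e * e) ([:- \<alpha>, 1:] * (lagrange N u i * lagrange N u k)))"
    for e
  have rem: "(rem \<longlongrightarrow> 0) (at 0)"
    unfolding rem_def c_def q_def
    using y d
  proof (rule next_moment_tendsto)
    show "L0 (pderiv (pderiv (node_square_poly N u \<alpha>))) = 0"
      unfolding L0_pderiv2_node_square_poly using \<alpha> by (simp add: w_def u_def)
  qed
  have M0: "Mbar N M = mixture N w u t0 (Polynomial.monom 1 (2 * N + 1))"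
    unfolding M_def Mbar_moment_map[OF N W] using t0
    by (simp add: moment_eq_mixture t0_def w_def u_def)
  have "eventually (\<lambda>e. - c + rem e =
      (Mbar N (M + e \<cdot>\<^sub>v unit_vec (dim_vec M) m) - Mbar N M) / e) (at 0)"
    using state pos eventually_neq_at_within[of 0 0 UNIV]
  proof eventually_elim
    case (elim e)
    define s where "s = y e * e"
    obtain \<omega> r where r: "inj_on r {..<N}" and \<omega>: "\<And>i. i < N \<Longrightarrow> \<omega> i > 0"
      and p: "monic_with_roots N u + (\<Sum>k<N. Polynomial.smult (d e k) (lagrange N u k)) = monic_with_roots N r"
      and quad: "\<And>P. Polynomial.degree P \<le> 2 * N \<Longrightarrow> L e s P = (\<Sum>i<N. \<omega> i * poly P (r i))"
      using elim(1) unfolding s_def by blast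
    have pos: "t0 + s > 0" using elim(2) by (simp add: s_def)
    have "\<exists>V\<in>Omega_open N. \<forall>k. moment N V k = mixture N \<omega> r (t0 + s) (Polynomial.monom 1 k)"
      by (rule Omega_open_witness) fact+
    then obtain V where V: "V \<in> Omega_open N"
      "\<And>k. moment N V k = mixture N \<omega> r (t0 + s) (Polynomial.monom 1 k)" by blast
    have "moment_map N V = M + e \<cdot>\<^sub>v unit_vec (dim_vec M) m"
    proof (rule eq_vecI)
      fix k assume "k < dim_vec (M + e \<cdot>\<^sub>v unit_vec (dim_vec M) m)"
      hence k: "k \<le> 2 * N" using M by simp
      have "moment N V k = L e s (heat (t0 + s) (Polynomial.monom 1 k))"
        using k by (subst quad) (simp_all add: V mixture_def degree_monom_eq)
      also have "\<dots> = M $ k + e * (if k = m then 1 else 0)"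
        using k by (simp add: L_def mixture_heat heat_heat M)
      finally show "moment_map N V $ k = (M + e \<cdot>\<^sub>v unit_vec (dim_vec M) m) $ k"
        using k m M by (simp add: moment_map_def)
    qed (simp add: M moment_map_def)
    hence "Mbar N (M + e \<cdot>\<^sub>v unit_vec (dim_vec M) m) =
        mixture N \<omega> r (t0 + s) (Polynomial.monom 1 (2 * N + 1))"
      using Mbar_moment_map[OF N V(1)] V(2) by simp
    also have "\<dots> = Mbar N M - e * c + (e * c - L e s q) +
        (\<Sum>i<N. \<Sum>k<N. d e i * d e k * L e s ([:- \<alpha>, 1:] * (lagrange N u i * lagrange N u k)))"
      unfolding M0 c_def q_def by (rule quadrature_next_moment[OF p quad m])
    finally have eq: "Mbar N (M + e \<cdot>\<^sub>v unit_vec (dim_vec M) m) - Mbar N M =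
        - e * c + (e * c - L e s q) +
        (\<Sum>i<N. \<Sum>k<N. d e i * d e k * L e s ([:- \<alpha>, 1:] * (lagrange N u i * lagrange N u k)))"
      by simp
    have "(\<Sum>i<N. \<Sum>k<N. d e i * d e k * L e s ([:- \<alpha>, 1:] * (lagrange N u i * lagrange N u k))) / e =
        (\<Sum>i<N. \<Sum>k<N. d e i * (d e k / e) * L e s ([:- \<alpha>, 1:] * (lagrange N u i * lagrange N u k)))"
      by (simp add: sum_divide_distrib)
    with elim(3) show ?case
      unfolding eq rem_def s_def[symmetric] by (simp add: add_divide_distrib diff_divide_distrib)
  qed
  moreover have "((\<lambda>e. - c + rem e) \<longlongrightarrow> - c) (at 0)"
    using tendsto_add[OF tendsto_const[of "- c"] rem] by simp
  ultimately have "((\<lambda>e. (Mbar N (M + e \<cdot>\<^sub>v unit_vec (dim_vec M) m) - Mbar N M) / e) \<longlongrightarrow> - c) (at 0)"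
    by (rule Lim_transform_eventually[rotated])
  moreover have "M + 0 \<cdot>\<^sub>v unit_vec (dim_vec M) m = M"
    by (intro eq_vecI) auto
  ultimately have "DERIV (\<lambda>e. Mbar N (M + e \<cdot>\<^sub>v unit_vec (dim_vec M) m)) 0 :> - c"
    by (simp add: DERIV_def)
  hence "partial_deriv (Mbar N) m M = - c"
    unfolding partial_deriv_def by (rule DERIV_imp_deriv)
  thus ?thesis by (simp add: M_def c_def q_def t0_def u_def)
qed

section \<open>Strict hyperbolicity\<close>

lemma node_square_poly_eq_monic_with_roots:
  "node_square_poly n u \<alpha> =
    monic_with_roots (2 * n + 1) (\<lambda>i. if i = 2 * n then \<alpha> else u (i div 2))"
proof -
  have "(\<Prod>i<2 * n. [:- (if i = 2 * n then \<alpha> else u (i div 2)), 1:]) =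
      (\<Prod>i<2 * n. [:- u (i div 2), 1:])"
    by (intro prod.cong) auto
  also have "\<dots> = monic_with_roots n u * monic_with_roots n u"
    by (induction n) (simp_all add: mult_ac del: mult_pCons_left mult_pCons_right)
  finally show ?thesis
    by (simp add: node_square_poly_def mult.commute del: mult_pCons_left mult_pCons_right)
qed

lemma eq_poly_eq_heat: "eq_poly N U t = heat (- t) (monic_with_roots (2 * N + 1) (\<lambda>_. U))"
proof -
  have "Polynomial.degree (monic_with_roots (2 * N + 1) (\<lambda>_. U)) \<le> 2 * N + 1"
    by (simp only: monic_with_roots_degree)
  from heat_eq_sum[OF this, of "- t"] show ?thesis
    by (simp add: eq_poly_def)
qed

text \<open>
  In both cases the characteristic polynomial is a monic polynomial with real roots, moved by the
  backward heat flow for the time $\sigma^2 > 0$: the polynomial with double roots at the nodes and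
  one further root in the first case, the power $(u - U)^{2N+1}$ in the second.
\<close>

theorem theorem4p4:
  fixes N :: nat
  assumes "N \<ge> 1"
  shows "(\<forall>M \<in> moment_map N ` Omega_W N.
            card {x :: real. eigenvalue (coeff_matrix N M) x} = 2 * N + 1) \<and>
         strictly_hyperbolic (2 * N + 1) (moment_map N ` Omega_W N) (coeff_matrix N)"
proof -
  have N: "N > 0" using assms by simp
  have card: "card {x. eigenvalue (coeff_matrix N M) x} = 2 * N + 1"
    if M: "M \<in> moment_map N ` Omega_W N" for M
  proof -
    have "\<exists>t r. t > 0 \<and> (\<forall>j\<le>2 * N. closure_coeff N M j =
      - Polynomial.coeff (heat (- t) (monic_with_roots (2 * N + 1) r)) j)"
    proof (cases "M \<in> moment_map N ` Omega_open N")
      case True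
      then obtain W where W: "W \<in> Omega_open N" "M = moment_map N W" by blast
      let ?p' = "\<lambda>i. poly (pderiv (monic_with_roots N (node W))) (node W i)"
      have pos: "weight W i * (?p' i)\<^sup>2 > 0" if i: "i < N" for i
      proof -
        have "?p' i \<noteq> 0"
          using i W(1) by (subst poly_pderiv_monic_with_roots) (auto simp: Omega_open_def)
        thus ?thesis using i W(1) by (simp add: Omega_open_def)
      qed
      obtain \<alpha> where \<alpha>: "(\<Sum>i<N. weight W i * (?p' i)\<^sup>2 * (node W i - \<alpha>)) = 0"
        using weighted_mean_ex[OF N, of "\<lambda>i. weight W i * (?p' i)\<^sup>2" "node W"] pos by blast
      have "\<forall>j\<le>2 * N. closure_coeff N M j =
          - Polynomial.coeff (heat (- sigma2 N W) (node_square_poly N (node W) \<alpha>)) j"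
        using True partial_deriv_Mbar[OF N W(1) _ \<alpha>] by (simp add: closure_coeff_def W(2))
      moreover have "sigma2 N W > 0" using W(1) by (simp add: Omega_open_def)
      ultimately show ?thesis
        unfolding node_square_poly_eq_monic_with_roots by (intro exI conjI)
    next
      case False
      define W where "W = (SOME W. W \<in> Omega_eq N \<and> moment_map N W = M)"
      have "\<exists>W. W \<in> Omega_eq N \<and> moment_map N W = M"
        using M False by (auto simp: Omega_W_def)
      from someI_ex[OF this] have W: "W \<in> Omega_eq N" by (simp add: W_def)
      have "\<forall>j\<le>2 * N. closure_coeff N M j =
          - Polynomial.coeff (heat (- sigma2 N W) (monic_with_roots (2 * N + 1) (\<lambda>_. node W 0))) j"
        using False by (simp only: closure_coeff_def W_def Let_def eq_poly_eq_heat if_False simp_thms)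
      moreover have "sigma2 N W > 0" using W by (simp add: Omega_eq_def)
      ultimately show ?thesis by (intro exI conjI)
    qed
    then obtain t r where t: "t > 0" and coeff: "\<And>j. j \<le> 2 * N \<Longrightarrow> closure_coeff N M j =
      - Polynomial.coeff (heat (- t) (monic_with_roots (2 * N + 1) r)) j" by blast
    have "Polynomial.degree (heat (- t) (monic_with_roots (2 * N + 1) r)) = 2 * N + 1"
      by (simp only: degree_heat monic_with_roots_degree)
    moreover have "lead_coeff (heat (- t) (monic_with_roots (2 * N + 1) r)) = 1"
      by (simp only: lead_coeff_heat monic_with_roots_degree monic_with_roots_coeff)
    ultimately have "eigenvalue (coeff_matrix N M) x \<longleftrightarrow>
        poly (heat (- t) (monic_with_roots (2 * N + 1) r)) x = 0" for x
      using coeff by (rule eigenvalue_coeff_matrix_iff)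
    thus ?thesis by (simp only: card_roots_heat_backward[OF t])
  qed
  moreover have "coeff_matrix N M \<in> carrier_mat (2 * N + 1) (2 * N + 1)" for M
    by (simp add: coeff_matrix_def)
  ultimately show ?thesis by (simp add: strictly_hyperbolic_def)
qed

end
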